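(* For every integer $n\ge1$, the sentence $TR^n$ (Hartogs' law of trichotomy for $n$-ary predicates) is HPL-independent from the set $choice_h^{(2)}$ of all Ackermann axioms; that is, neither $TR^n$ nor $\neg TR^n$ is a consequence of $choice_h^{(2)}$ in second-order predicate logic with Henkin interpretation.
   Context: Language: second-order formulas (the set $\mathcal{L}^{(2)}$) are built from individual variables, $n$-ary predicate variables for each $n\ge1$ ("variables of sort $n$"), identity between individuals, connectives, and quantifiers over individual variables and over predicate variables of every sort. For $r,m\ge1$, let $\boldsymbol{x}=(x_1,\dots,x_r)$ and $\boldsymbol{y}=(y_1,\dots,y_m)$ be tuples of individual variables and let $D$ be a predicate variable of sort $m$; $\mathcal{L}^{(2)}_{\boldsymbol{x},D}$ is the set of formulas $H=H(\boldsymbol{x},D)$ in which $x_1,\dots,x_r$ and $D$ occur only free (i.e. not bound); $H$ may contain further free individual and predicate variables. Structures: for a non-empty set $I$, an $n$-ary predicate on $I$ is a function $\alpha:I^n\to\{true,false\}$, identified with a subset of $I^n$. A predicate structure over $I$ is a sequence $\Sigma=(J_n)_{n\ge0}$ with $J_0=I$ and each $J_n$ ($n\ge1$) a non-empty set of $n$-ary predicates on $I$. Individual variables range over $J_0$ and predicate variables of sort $n$ range over $J_n$. $\Sigma\models\varphi$ means that $\varphi$ is true in $\Sigma$ under every assignment of the variables in $\Sigma$. $\Sigma$ is a Henkin-Asser structure if it satisfies full second-order comprehension: for every formula $H$, all distinct individual variables $x_1,\dots,x_n$ and every assignment $f$, the $n$-ary predicate $\{(\xi_1,\dots,\xi_n)\in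 I^n\mid H$ is true in $\Sigma$ under $f$ modified by $x_i\mapsto\xi_i\}$ belongs to $J_n$. HPL (second-order predicate logic with Henkin interpretation): $\psi$ is an HPL-consequence of a set $\Gamma$ of formulas if $\psi$ holds in every Henkin-Asser structure that is a model of $\Gamma$. A sentence $\psi$ is HPL-independent from $\Gamma$ if neither $\psi$ nor $\neg\psi$ is an HPL-consequence of $\Gamma$; equivalently, there are Henkin-Asser structures that are models of $\Gamma\cup\{\psi\}$ and of $\Gamma\cup\{\neg\psi\}$, respectively. Ackermann axioms: $choice_h^{(2)}=\bigcup_{r,m\ge1}choice_h^{r,m}$ with $choice_h^{r,m}=\{choice_h^{r,m}(H)\mid H\in\mathcal{L}^{(2)}_{\boldsymbol{x},D}\}$, where $$choice_h^{r,m}(H)=\ \forall\boldsymbol{x}\,\exists D\,H(\boldsymbol{x},D)\to\exists S\,\forall\boldsymbol{x}\,\exists D\,\big(\forall\boldsymbol{y}(D\boldsymbol{y}\leftrightarrow S\boldsymbol{x}\boldsymbol{y})\land H(\boldsymbol{x},D)\big)$$ and $S$ is a predicate variable of sort $r+m$ not occurring in $H$. Trichotomy: $TR^n=\forall A\,\forall B\,([A\lesssim B]\lor[B\lesssim A])$, where $A,B$ are variables of sort $n$ and $[A\lesssim B]$ is the second-order formula stating that there is a predicate of sort $2n$ that is (the graph of) a one-to-one function from $A$ into $B$: with $\boldsymbol{x},\boldsymbol{x}',\boldsymbol{y}$ denoting $n$-tuples of individual variables, there is $R$ of sort $2n$ such that for every $\boldsymbol{x}$ with $A\boldsymbol{x}$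 there is exactly one $\boldsymbol{y}$ with $B\boldsymbol{y}\land R\boldsymbol{x}\boldsymbol{y}$, and $A\boldsymbol{x}\land A\boldsymbol{x}'\land B\boldsymbol{y}\land R\boldsymbol{x}\boldsymbol{y}\land R\boldsymbol{x}'\boldsymbol{y}$ implies $\boldsymbol{x}=\boldsymbol{x}'$. *)

theory Defs
  imports Main
begin

section \<open>Second-order formulas\<close>

type_synonym ivar = nat

text \<open>\<open>PVar n k\<close> is the \<open>k\<close>-th predicate variable of sort \<open>n\<close>.  Sort \<open>0\<close> is excluded by \<open>wf_fm\<close>.\<close>

datatype pvar = PVar (psort: nat) nat

datatype fm =
    IEq ivar ivar
  | App pvar "ivar list"
  | Neg fm
  | And fm fm
  | Or fm fm
  | Imp fm fm
  | Iff fm fm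
  | AllI ivar fm
  | ExI ivar fm
  | AllP pvar fm
  | ExP pvar fm

primrec wf_fm :: "fm \<Rightarrow> bool" where
  "wf_fm (IEq x y) \<longleftrightarrow> True"
| "wf_fm (App P xs) \<longleftrightarrow> psort P \<ge> 1 \<and> length xs = psort P"
| "wf_fm (Neg \<phi>) \<longleftrightarrow> wf_fm \<phi>"
| "wf_fm (And \<phi> \<psi>) \<longleftrightarrow> wf_fm \<phi> \<and> wf_fm \<psi>"
| "wf_fm (Or \<phi> \<psi>) \<longleftrightarrow> wf_fm \<phi> \<and> wf_fm \<psi>"
| "wf_fm (Imp \<phi> \<psi>) \<longleftrightarrow> wf_fm \<phi> \<and> wf_fm \<psi>"
| "wf_fm (Iff \<phi> \<psi>) \<longleftrightarrow> wf_fm \<phi> \<and> wf_fm \<psi>"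
| "wf_fm (AllI x \<phi>) \<longleftrightarrow> wf_fm \<phi>"
| "wf_fm (ExI x \<phi>) \<longleftrightarrow> wf_fm \<phi>"
| "wf_fm (AllP P \<phi>) \<longleftrightarrow> psort P \<ge> 1 \<and> wf_fm \<phi>"
| "wf_fm (ExP P \<phi>) \<longleftrightarrow> psort P \<ge> 1 \<and> wf_fm \<phi>"

primrec free_ivars :: "fm \<Rightarrow> ivar set" where
  "free_ivars (IEq x y) = {x, y}"
| "free_ivars (App P xs) = set xs"
| "free_ivars (Neg \<phi>) = free_ivars \<phi>"
| "free_ivars (And \<phi> \<psi>) = free_ivars \<phi> \<union> free_ivars \<psi>"
| "free_ivars (Or \<phi> \<psi>) = free_ivars \<phi> \<union> free_ivars \<psi>"
| "free_ivars (Imp \<phi> \<psi>) = free_ivars \<phi> \<union> free_ivars \<psi>"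
| "free_ivars (Iff \<phi> \<psi>) = free_ivars \<phi> \<union> free_ivars \<psi>"
| "free_ivars (AllI x \<phi>) = free_ivars \<phi> - {x}"
| "free_ivars (ExI x \<phi>) = free_ivars \<phi> - {x}"
| "free_ivars (AllP P \<phi>) = free_ivars \<phi>"
| "free_ivars (ExP P \<phi>) = free_ivars \<phi>"

primrec free_pvars :: "fm \<Rightarrow> pvar set" where
  "free_pvars (IEq x y) = {}"
| "free_pvars (App P xs) = {P}"
| "free_pvars (Neg \<phi>) = free_pvars \<phi>"
| "free_pvars (And \<phi> \<psi>) = free_pvars \<phi> \<union> free_pvars \<psi>"
| "free_pvars (Or \<phi> \<psi>) = free_pvars \<phi> \<union> free_pvars \<psi>"
| "free_pvars (Imp \<phi> \<psi>) = free_pvars \<phi> \<union> free_pvars \<psi>"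
| "free_pvars (Iff \<phi> \<psi>) = free_pvars \<phi> \<union> free_pvars \<psi>"
| "free_pvars (AllI x \<phi>) = free_pvars \<phi>"
| "free_pvars (ExI x \<phi>) = free_pvars \<phi>"
| "free_pvars (AllP P \<phi>) = free_pvars \<phi> - {P}"
| "free_pvars (ExP P \<phi>) = free_pvars \<phi> - {P}"

primrec bound_ivars :: "fm \<Rightarrow> ivar set" where
  "bound_ivars (IEq x y) = {}"
| "bound_ivars (App P xs) = {}"
| "bound_ivars (Neg \<phi>) = bound_ivars \<phi>"
| "bound_ivars (And \<phi> \<psi>) = bound_ivars \<phi> \<union> bound_ivars \<psi>"
| "bound_ivars (Or \<phi> \<psi>) = bound_ivars \<phi> \<union> bound_ivars \<psi>"
| "bound_ivars (Imp \<phi> \<psi>) = bound_ivars \<phi> \<union> bound_ivars \<psi>"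
| "bound_ivars (Iff \<phi> \<psi>) = bound_ivars \<phi> \<union> bound_ivars \<psi>"
| "bound_ivars (AllI x \<phi>) = insert x (bound_ivars \<phi>)"
| "bound_ivars (ExI x \<phi>) = insert x (bound_ivars \<phi>)"
| "bound_ivars (AllP P \<phi>) = bound_ivars \<phi>"
| "bound_ivars (ExP P \<phi>) = bound_ivars \<phi>"

primrec bound_pvars :: "fm \<Rightarrow> pvar set" where
  "bound_pvars (IEq x y) = {}"
| "bound_pvars (App P xs) = {}"
| "bound_pvars (Neg \<phi>) = bound_pvars \<phi>"
| "bound_pvars (And \<phi> \<psi>) = bound_pvars \<phi> \<union> bound_pvars \<psi>"
| "bound_pvars (Or \<phi> \<psi>) = bound_pvars \<phi> \<union> bound_pvars \<psi>"
| "bound_pvars (Imp \<phi> \<psi>) = bound_pvars \<phi> \<union> bound_pvars \<psi>"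
| "bound_pvars (Iff \<phi> \<psi>) = bound_pvars \<phi> \<union> bound_pvars \<psi>"
| "bound_pvars (AllI x \<phi>) = bound_pvars \<phi>"
| "bound_pvars (ExI x \<phi>) = bound_pvars \<phi>"
| "bound_pvars (AllP P \<phi>) = insert P (bound_pvars \<phi>)"
| "bound_pvars (ExP P \<phi>) = insert P (bound_pvars \<phi>)"

definition sentence :: "fm \<Rightarrow> bool" where
  "sentence \<phi> \<longleftrightarrow> wf_fm \<phi> \<and> free_ivars \<phi> = {} \<and> free_pvars \<phi> = {}"

definition alls :: "ivar list \<Rightarrow> fm \<Rightarrow> fm" where
  "alls xs \<phi> = foldr AllI xs \<phi>"

definition exs :: "ivar list \<Rightarrow> fm \<Rightarrow> fm" where
  "exs xs \<phi> = foldr ExI xs \<phi>"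

text \<open>Only applied to nonempty lists, so that no formula for truth is needed.\<close>

fun conjs :: "fm list \<Rightarrow> fm" where
  "conjs [\<phi>] = \<phi>"
| "conjs (\<phi> # \<psi> # \<phi>s) = And \<phi> (conjs (\<psi> # \<phi>s))"

definition tuple_eq :: "ivar list \<Rightarrow> ivar list \<Rightarrow> fm" where
  "tuple_eq xs ys = conjs (map2 IEq xs ys)"


section \<open>Predicate structures\<close>

text \<open>An \<open>n\<close>-ary predicate is identified with the set of argument lists of length \<open>n\<close> at which it
  is true.  The field \<open>preds n\<close> is irrelevant for \<open>n = 0\<close>.\<close>

record 'a pred_structure =
  indiv :: "'a set"
  preds :: "nat \<Rightarrow> 'a list set set"

definition tuples :: "'a set \<Rightarrow> nat \<Rightarrow> 'a list set" where
  "tuples I n = {\<xi>. set \<xi> \<subseteq> I \<and> length \<xi> = n}"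

definition predicate_structure :: "'a pred_structure \<Rightarrow> bool" where
  "predicate_structure M \<longleftrightarrow>
     indiv M \<noteq> {} \<and> (\<forall>n\<ge>1. preds M n \<noteq> {} \<and> preds M n \<subseteq> Pow (tuples (indiv M) n))"

definition assignment :: "'a pred_structure \<Rightarrow> (ivar \<Rightarrow> 'a) \<Rightarrow> (pvar \<Rightarrow> 'a list set) \<Rightarrow> bool" where
  "assignment M f g \<longleftrightarrow>
     (\<forall>x. f x \<in> indiv M) \<and> (\<forall>P. psort P \<ge> 1 \<longrightarrow> g P \<in> preds M (psort P))"

primrec sat ::
  "'a pred_structure \<Rightarrow> (ivar \<Rightarrow> 'a) \<Rightarrow> (pvar \<Rightarrow> 'a list set) \<Rightarrow> fm \<Rightarrow> bool" where
  "sat M f g (IEq x y) \<longleftrightarrow> f x = f y"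
| "sat M f g (App P xs) \<longleftrightarrow> map f xs \<in> g P"
| "sat M f g (Neg \<phi>) \<longleftrightarrow> \<not> sat M f g \<phi>"
| "sat M f g (And \<phi> \<psi>) \<longleftrightarrow> sat M f g \<phi> \<and> sat M f g \<psi>"
| "sat M f g (Or \<phi> \<psi>) \<longleftrightarrow> sat M f g \<phi> \<or> sat M f g \<psi>"
| "sat M f g (Imp \<phi> \<psi>) \<longleftrightarrow> (sat M f g \<phi> \<longrightarrow> sat M f g \<psi>)"
| "sat M f g (Iff \<phi> \<psi>) \<longleftrightarrow> (sat M f g \<phi> \<longleftrightarrow> sat M f g \<psi>)"
| "sat M f g (AllI x \<phi>) \<longleftrightarrow> (\<forall>\<xi>\<in>indiv M. sat M (f(x := \<xi>)) g \<phi>)"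
| "sat M f g (ExI x \<phi>) \<longleftrightarrow> (\<exists>\<xi>\<in>indiv M. sat M (f(x := \<xi>)) g \<phi>)"
| "sat M f g (AllP P \<phi>) \<longleftrightarrow> (\<forall>\<alpha>\<in>preds M (psort P). sat M f (g(P := \<alpha>)) \<phi>)"
| "sat M f g (ExP P \<phi>) \<longleftrightarrow> (\<exists>\<alpha>\<in>preds M (psort P). sat M f (g(P := \<alpha>)) \<phi>)"

definition models :: "'a pred_structure \<Rightarrow> fm \<Rightarrow> bool" where
  "models M \<phi> \<longleftrightarrow> (\<forall>f g. assignment M f g \<longrightarrow> sat M f g \<phi>)"

definition updates :: "(ivar \<Rightarrow> 'a) \<Rightarrow> ivar list \<Rightarrow> 'a list \<Rightarrow> ivar \<Rightarrow> 'a" where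
  "updates f xs \<xi> = (\<lambda>v. case map_of (zip xs \<xi>) v of Some a \<Rightarrow> a | None \<Rightarrow> f v)"

definition henkin_asser :: "'a pred_structure \<Rightarrow> bool" where
  "henkin_asser M \<longleftrightarrow> predicate_structure M \<and>
     (\<forall>H xs f g. wf_fm H \<and> xs \<noteq> [] \<and> distinct xs \<and> assignment M f g \<longrightarrow>
        {\<xi> \<in> tuples (indiv M) (length xs). sat M (updates f xs \<xi>) g H} \<in> preds M (length xs))"


section \<open>Consequence and independence\<close>

text \<open>HOL cannot quantify over types inside a formula, so these notions are relative to an ambient
  type \<open>'a\<close> whose nonempty subsets serve as domains of individuals.  Independence relative to
  \<open>'a\<close> provides the two separating structures and hence implies independence in the sense of all
  structures; conversely, by the downward Loewenheim-Skolem theorem for Henkin structures, every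
  infinite \<open>'a\<close> is large enough to witness each failure of consequence.\<close>

definition hpl_consequence :: "'a itself \<Rightarrow> fm set \<Rightarrow> fm \<Rightarrow> bool" where
  "hpl_consequence _ \<Gamma> \<psi> \<longleftrightarrow>
     (\<forall>M :: 'a pred_structure. henkin_asser M \<and> (\<forall>\<phi>\<in>\<Gamma>. models M \<phi>) \<longrightarrow> models M \<psi>)"

definition hpl_independent :: "'a itself \<Rightarrow> fm \<Rightarrow> fm set \<Rightarrow> bool" where
  "hpl_independent T \<psi> \<Gamma> \<longleftrightarrow>
     sentence \<psi> \<and> \<not> hpl_consequence T \<Gamma> \<psi> \<and> \<not> hpl_consequence T \<Gamma> (Neg \<psi>)"


section \<open>Ackermann axioms\<close>

definition L2 :: "ivar list \<Rightarrow> pvar \<Rightarrow> fm set" where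
  "L2 xs D = {H. wf_fm H \<and> set xs \<inter> bound_ivars H = {} \<and> D \<notin> bound_pvars H}"

definition ackermann_fm :: "ivar list \<Rightarrow> ivar list \<Rightarrow> pvar \<Rightarrow> pvar \<Rightarrow> fm \<Rightarrow> fm" where
  "ackermann_fm xs ys D S H =
     Imp (alls xs (ExP D H))
         (ExP S (alls xs (ExP D
            (And (alls ys (Iff (App D ys) (App S (xs @ ys)))) H))))"

text \<open>The variables of the tuples \<open>xs\<close>, \<open>ys\<close> are pairwise distinct; the \<open>ys\<close> may occur in \<open>H\<close>.\<close>

definition choice_h :: "nat \<Rightarrow> nat \<Rightarrow> fm set" where
  "choice_h r m = {ackermann_fm xs ys D S H | xs ys D S H.
     length xs = r \<and> length ys = m \<and> distinct (xs @ ys) \<and>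
     psort D = m \<and> psort S = r + m \<and> H \<in> L2 xs D \<and>
     S \<notin> free_pvars H \<union> bound_pvars H}"

definition choice_h2 :: "fm set" where
  "choice_h2 = (\<Union>r\<in>{1..}. \<Union>m\<in>{1..}. choice_h r m)"


section \<open>Trichotomy\<close>

definition lesssim :: "nat \<Rightarrow> pvar \<Rightarrow> pvar \<Rightarrow> fm" where
  "lesssim n A B =
     (let R = PVar (2 * n) 0;
          xs = [0..<n]; xs' = [n..<2 * n]; ys = [2 * n..<3 * n]; zs = [3 * n..<4 * n]
      in ExP R (And
           (alls xs (Imp (App A xs)
              (exs ys (And (And (App B ys) (App R (xs @ ys)))
                 (alls zs (Imp (And (App B zs) (App R (xs @ zs))) (tuple_eq zs ys)))))))
           (alls xs (alls xs' (alls ys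
              (Imp (conjs [App A xs, App A xs', App B ys, App R (xs @ ys), App R (xs' @ ys)])
                   (tuple_eq xs xs')))))))"

definition TR :: "nat \<Rightarrow> fm" where
  "TR n = (let A = PVar n 0; B = PVar n 1
           in AllP A (AllP B (Or (lesssim n A B) (lesssim n B A))))"

end

theory Submission
  imports Defs "HOL-Combinatorics.Transposition" "HOL-Library.Infinite_Set"
begin

text \<open>Over a single individual, the structure of all predicates satisfies choice and trichotomy
  trivially.  For the other direction, colour the individuals with two colours, each used infinitely
  often, and take the predicates that are invariant under all colour-preserving permutations fixing
  some finite set (a support) pointwise.  There the two colour classes, or their diagonals in
  arity \<open>n\<close>, admit no injection either way.  The Ackermann axioms nevertheless hold: witnesses \<open>D\<close> for
  all tuples \<open>x\<close> can be found with support in \<open>E \<union> x\<close> for one fixed finite set \<open>E\<close>, and choosing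
  one witness for a representative of each orbit of tuples over \<open>E\<close> and transporting it along the
  orbit gives a choice function with support \<open>E\<close>.\<close>

section \<open>Semantics of formulas\<close>

lemma sat_cong:
  assumes "\<And>x. x \<in> free_ivars \<phi> \<Longrightarrow> f x = f' x" "\<And>P. P \<in> free_pvars \<phi> \<Longrightarrow> g P = g' P"
  shows "sat M f g \<phi> \<longleftrightarrow> sat M f' g' \<phi>"
  using assms
proof (induction \<phi> arbitrary: f f' g g')
  case (App P xs)
  then have "map f xs = map f' xs" by simp
  moreover have "g P = g' P" using App by simp
  ultimately show ?case unfolding sat.simps by (rule arg_cong2)
next
  case (AllI x \<phi>)
  have "sat M (f(x := a)) g \<phi> \<longleftrightarrow> sat M (f'(x := a)) g' \<phi>" for a
    by (rule AllI.IH) (use AllI.prems in auto)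
  then show ?case by simp
next
  case (ExI x \<phi>)
  have "sat M (f(x := a)) g \<phi> \<longleftrightarrow> sat M (f'(x := a)) g' \<phi>" for a
    by (rule ExI.IH) (use ExI.prems in auto)
  then show ?case by simp
next
  case (AllP P \<phi>)
  have "sat M f (g(P := a)) \<phi> \<longleftrightarrow> sat M f' (g'(P := a)) \<phi>" for a
    by (rule AllP.IH) (use AllP.prems in auto)
  then show ?case by simp
next
  case (ExP P \<phi>)
  have "sat M f (g(P := a)) \<phi> \<longleftrightarrow> sat M f' (g'(P := a)) \<phi>" for a
    by (rule ExP.IH) (use ExP.prems in auto)
  then show ?case by simp
next
  case (And \<phi> \<psi>)
  have "sat M f g \<phi> \<longleftrightarrow> sat M f' g' \<phi>" "sat M f g \<psi> \<longleftrightarrow> sat M f' g' \<psi>"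
    using And.prems by (auto intro!: And.IH)
  then show ?case by simp
next
  case (Or \<phi> \<psi>)
  have "sat M f g \<phi> \<longleftrightarrow> sat M f' g' \<phi>" "sat M f g \<psi> \<longleftrightarrow> sat M f' g' \<psi>"
    using Or.prems by (auto intro!: Or.IH)
  then show ?case by simp
next
  case (Imp \<phi> \<psi>)
  have "sat M f g \<phi> \<longleftrightarrow> sat M f' g' \<phi>" "sat M f g \<psi> \<longleftrightarrow> sat M f' g' \<psi>"
    using Imp.prems by (auto intro!: Imp.IH)
  then show ?case by simp
next
  case (Iff \<phi> \<psi>)
  have "sat M f g \<phi> \<longleftrightarrow> sat M f' g' \<phi>" "sat M f g \<psi> \<longleftrightarrow> sat M f' g' \<psi>"
    using Iff.prems by (auto intro!: Iff.IH)
  then show ?case by simp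
next
  case (Neg \<phi>)
  have "sat M f g \<phi> \<longleftrightarrow> sat M f' g' \<phi>"
    by (rule Neg.IH) (use Neg.prems in auto)
  then show ?case by simp
qed auto

lemma finite_free_ivars [simp]: "finite (free_ivars \<phi>)"
  by (induction \<phi>) auto

lemma finite_free_pvars [simp]: "finite (free_pvars \<phi>)"
  by (induction \<phi>) auto

text \<open>\<open>assignment\<close> constrains only predicate variables of positive sort. Every
  free predicate variable of a well-formed formula is among them, and a variable of sort 0 is never
  free in one.\<close>

lemma wf_fm_psort_pos: "wf_fm \<phi> \<Longrightarrow> P \<in> free_pvars \<phi> \<Longrightarrow> psort P \<ge> 1"
  by (induction \<phi>) auto

section \<open>Updating a whole tuple of variables\<close>

lemma updates_notin: "x \<notin> set xs \<Longrightarrow> updates f xs \<xi> x = f x"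
  unfolding updates_def by (auto split: option.splits dest!: map_of_SomeD set_zip_leftD)

lemma map_updates_notin: "set xs \<inter> set zs = {} \<Longrightarrow> map (updates f xs \<xi>) zs = map f zs"
  by (intro map_cong[OF refl] updates_notin) blast

lemma updates_Cons: "updates f (x # xs) (a # \<xi>) = (updates f xs \<xi>)(x := a)"
  by (auto simp: updates_def)

lemma updates_Nil [simp]: "updates f [] \<xi> = f"
  by (simp add: updates_def)

text \<open>In the induction over a quantifier block, the head quantifier updates \<open>f\<close>
  before the rest of the block does; distinctness lets the two orders be exchanged.\<close>

lemma updates_upd: "x \<notin> set xs \<Longrightarrow> updates (f(x := a)) xs \<xi> = (updates f xs \<xi>)(x := a)"
proof
  fix y
  assume x: "x \<notin> set xs"
  show "updates (f(x := a)) xs \<xi> y = ((updates f xs \<xi>)(x := a)) y"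
  proof (cases "y = x")
    case True
    then show ?thesis using updates_notin[OF x, of "f(x := a)" \<xi>] by simp
  next
    case False
    then show ?thesis by (simp add: updates_def split: option.splits)
  qed
qed

lemma map_updates: "distinct xs \<Longrightarrow> length xs = length \<xi> \<Longrightarrow> map (updates f xs \<xi>) xs = \<xi>"
proof (induction xs arbitrary: \<xi>)
  case (Cons x xs)
  then obtain a \<zeta> where \<xi>: "\<xi> = a # \<zeta>" by (cases \<xi>) auto
  have "map ((updates f xs \<zeta>)(x := a)) xs = map (updates f xs \<zeta>) xs"
    using Cons.prems by auto
  also have "\<dots> = \<zeta>" using Cons \<xi> by simp
  finally show ?case by (simp only: \<xi> updates_Cons list.map fun_upd_same)
qed simp

lemma comp_updates: "h \<circ> updates f xs \<xi> = updates (h \<circ> f) xs (map h \<xi>)"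
  by (auto simp: updates_def fun_eq_iff zip_map2 map_of_map split: option.splits)

section \<open>Tuples and blocks of individual quantifiers\<close>

lemma tuples_0 [simp]: "tuples I 0 = {[]}"
  by (auto simp: tuples_def)

lemma tuples_Suc: "tuples I (Suc n) = (\<Union>a\<in>I. (#) a ` tuples I n)"
proof (intro equalityI subsetI)
  fix \<xi> assume "\<xi> \<in> tuples I (Suc n)"
  then show "\<xi> \<in> (\<Union>a\<in>I. (#) a ` tuples I n)"
    by (cases \<xi>) (auto simp: tuples_def)
qed (auto simp: tuples_def)

lemma ball_tuples_Suc: "(\<forall>\<xi>\<in>tuples I (Suc n). P \<xi>) \<longleftrightarrow> (\<forall>a\<in>I. \<forall>\<xi>\<in>tuples I n. P (a # \<xi>))"
  by (simp add: tuples_Suc)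

lemma bex_tuples_Suc: "(\<exists>\<xi>\<in>tuples I (Suc n). P \<xi>) \<longleftrightarrow> (\<exists>a\<in>I. \<exists>\<xi>\<in>tuples I n. P (a # \<xi>))"
  by (simp add: tuples_Suc)

lemma sat_alls:
  "distinct xs \<Longrightarrow>
    sat M f g (alls xs \<phi>) \<longleftrightarrow> (\<forall>\<xi>\<in>tuples (indiv M) (length xs). sat M (updates f xs \<xi>) g \<phi>)"
  by (induction xs arbitrary: f)
    (simp_all add: alls_def ball_tuples_Suc updates_Cons updates_upd)

lemma sat_exs:
  "distinct xs \<Longrightarrow>
    sat M f g (exs xs \<phi>) \<longleftrightarrow> (\<exists>\<xi>\<in>tuples (indiv M) (length xs). sat M (updates f xs \<xi>) g \<phi>)"
  by (induction xs arbitrary: f)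
    (simp_all add: exs_def bex_tuples_Suc updates_Cons updates_upd)

lemma sat_conjs: "\<phi>s \<noteq> [] \<Longrightarrow> sat M f g (conjs \<phi>s) \<longleftrightarrow> (\<forall>\<phi>\<in>set \<phi>s. sat M f g \<phi>)"
  by (induction \<phi>s rule: conjs.induct) auto

lemma sat_tuple_eq:
  assumes "xs \<noteq> []" "length xs = length ys"
  shows "sat M f g (tuple_eq xs ys) \<longleftrightarrow> map f xs = map f ys"
proof -
  have "map2 IEq xs ys \<noteq> []" using assms by (cases xs; cases ys) auto
  then have "sat M f g (tuple_eq xs ys) \<longleftrightarrow> (\<forall>\<phi>\<in>set (map2 IEq xs ys). sat M f g \<phi>)"
    unfolding tuple_eq_def by (rule sat_conjs)
  also have "\<dots> \<longleftrightarrow> map f xs = map f ys"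
    using assms(2) by (induction xs ys rule: list_induct2) auto
  finally show ?thesis .
qed

lemma length_tuples: "\<xi> \<in> tuples I n \<Longrightarrow> length \<xi> = n"
  by (simp add: tuples_def)

section \<open>Semantic form of the comparison formula\<close>

lemma sat_functional:
  assumes "distinct xs" "distinct ys" "distinct zs"
    and "set xs \<inter> set ys = {}" "set xs \<inter> set zs = {}" "set ys \<inter> set zs = {}"
    and "length xs = n" "length ys = n" "length zs = n" "n \<ge> 1"
  shows "sat M f g (alls xs (Imp (App A xs)
      (exs ys (And (And (App B ys) (App R (xs @ ys)))
         (alls zs (Imp (And (App B zs) (App R (xs @ zs))) (tuple_eq zs ys))))))) \<longleftrightarrow>
    (\<forall>\<xi>\<in>tuples (indiv M) n. \<xi> \<in> g A \<longrightarrow> (\<exists>\<eta>\<in>tuples (indiv M) n. \<eta> \<in> g B \<and> \<xi> @ \<eta> \<in> g R \<and>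
      (\<forall>\<zeta>\<in>tuples (indiv M) n. \<zeta> \<in> g B \<and> \<xi> @ \<zeta> \<in> g R \<longrightarrow> \<zeta> = \<eta>)))"
proof -
  have ne: "ys \<noteq> []" "zs \<noteq> []" using assms by auto
  \<comment> \<open>As the blocks are disjoint, a later block leaves the values of the earlier ones
    alone, so each variable tuple evaluates to its own tuple.\<close>
  have disj: "set ys \<inter> set xs = {}" "set zs \<inter> set xs = {}" "set zs \<inter> set ys = {}"
    using assms by blast+
  show ?thesis
    using assms(1-9) ne disj
    by (simp add: sat_alls sat_exs sat_tuple_eq map_updates map_updates_notin length_tuples
        cong: ball_cong bex_cong)
qed

lemma sat_injective:
  assumes "distinct xs" "distinct xs'" "distinct ys"
    and "set xs \<inter> set xs' = {}" "set xs \<inter> set ys = {}" "set xs' \<inter> set ys = {}"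
    and "length xs = n" "length xs' = n" "length ys = n" "n \<ge> 1"
  shows "sat M f g (alls xs (alls xs' (alls ys
      (Imp (conjs [App A xs, App A xs', App B ys, App R (xs @ ys), App R (xs' @ ys)])
           (tuple_eq xs xs'))))) \<longleftrightarrow>
    (\<forall>\<xi>\<in>tuples (indiv M) n. \<forall>\<xi>'\<in>tuples (indiv M) n. \<forall>\<eta>\<in>tuples (indiv M) n.
      \<xi> \<in> g A \<and> \<xi>' \<in> g A \<and> \<eta> \<in> g B \<and> \<xi> @ \<eta> \<in> g R \<and> \<xi>' @ \<eta> \<in> g R \<longrightarrow> \<xi> = \<xi>')"
proof -
  have ne: "xs \<noteq> []" "xs' \<noteq> []" using assms by auto
  have disj: "set xs' \<inter> set xs = {}" "set ys \<inter> set xs = {}" "set ys \<inter> set xs' = {}"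
    using assms by blast+
  show ?thesis
    using assms(1-9) ne disj
    by (simp add: sat_alls sat_tuple_eq map_updates map_updates_notin length_tuples cong: ball_cong)
qed

lemma sat_lesssim:
  assumes n: "n \<ge> 1" and sorts: "psort A = n" "psort B = n"
    and sub: "g A \<subseteq> tuples (indiv M) n" "g B \<subseteq> tuples (indiv M) n"
  shows "sat M f g (lesssim n A B) \<longleftrightarrow>
    (\<exists>R\<in>preds M (2 * n).
       (\<forall>\<xi>\<in>g A. \<exists>\<eta>\<in>g B. \<xi> @ \<eta> \<in> R \<and> (\<forall>\<zeta>\<in>g B. \<xi> @ \<zeta> \<in> R \<longrightarrow> \<zeta> = \<eta>)) \<and>
       (\<forall>\<xi>\<in>g A. \<forall>\<xi>'\<in>g A. \<forall>\<eta>\<in>g B. \<xi> @ \<eta> \<in> R \<longrightarrow> \<xi>' @ \<eta> \<in> R \<longrightarrow> \<xi> = \<xi>'))"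
proof -
  let ?R = "PVar (2 * n) 0"
  \<comment> \<open>\<open>R\<close> has sort \<open>2 * n\<close>, which differs from
    \<open>n\<close> because \<open>n \<ge> 1\<close>, so binding it disturbs neither
    \<open>A\<close> nor \<open>B\<close>.\<close>
  have "psort ?R \<noteq> n" using n by simp
  then have neq: "A \<noteq> ?R" "B \<noteq> ?R" using sorts by blast+
  \<comment> \<open>Since \<open>A\<close> and \<open>B\<close> denote sets of
    \<open>n\<close>-tuples, quantifiers over all tuples relativised to them become plain
    quantifiers over these sets.\<close>
  have all: "(\<forall>x\<in>T. x \<in> X \<and> P x \<longrightarrow> Q x) \<longleftrightarrow> (\<forall>x\<in>X. P x \<longrightarrow> Q x)"
    "(\<forall>x\<in>T. x \<in> X \<longrightarrow> Q x) \<longleftrightarrow> (\<forall>x\<in>X. Q x)"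
    "(\<exists>x\<in>T. x \<in> X \<and> Q x) \<longleftrightarrow> (\<exists>x\<in>X. Q x)"
    if "X \<subseteq> T" for X T :: "'a list set" and P Q
    using that by blast+
  have inj: "(\<forall>\<xi>\<in>T. \<forall>\<xi>'\<in>T. \<forall>\<eta>\<in>T.
        \<xi> \<in> X \<and> \<xi>' \<in> X \<and> \<eta> \<in> Y \<and> \<xi> @ \<eta> \<in> R \<and> \<xi>' @ \<eta> \<in> R \<longrightarrow> \<xi> = \<xi>') \<longleftrightarrow>
      (\<forall>\<xi>\<in>X. \<forall>\<xi>'\<in>X. \<forall>\<eta>\<in>Y. \<xi> @ \<eta> \<in> R \<longrightarrow> \<xi>' @ \<eta> \<in> R \<longrightarrow> \<xi> = \<xi>')"
    if "X \<subseteq> T" "Y \<subseteq> T" for X Y T R :: "'a list set"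
    using subsetD[OF that(1)] subsetD[OF that(2)] by meson
  have functional: "sat M f g' (alls [0..<n] (Imp (App A [0..<n])
      (exs [2 * n..<3 * n] (And (And (App B [2 * n..<3 * n]) (App ?R ([0..<n] @ [2 * n..<3 * n])))
         (alls [3 * n..<4 * n] (Imp (And (App B [3 * n..<4 * n]) (App ?R ([0..<n] @ [3 * n..<4 * n])))
            (tuple_eq [3 * n..<4 * n] [2 * n..<3 * n]))))))) \<longleftrightarrow>
    (\<forall>\<xi>\<in>tuples (indiv M) n. \<xi> \<in> g' A \<longrightarrow> (\<exists>\<eta>\<in>tuples (indiv M) n. \<eta> \<in> g' B \<and> \<xi> @ \<eta> \<in> g' ?R \<and>
      (\<forall>\<zeta>\<in>tuples (indiv M) n. \<zeta> \<in> g' B \<and> \<xi> @ \<zeta> \<in> g' ?R \<longrightarrow> \<zeta> = \<eta>)))" for g'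
    by (rule sat_functional) (use n in auto)
  have injective: "sat M f g' (alls [0..<n] (alls [n..<2 * n] (alls [2 * n..<3 * n]
      (Imp (conjs [App A [0..<n], App A [n..<2 * n], App B [2 * n..<3 * n],
          App ?R ([0..<n] @ [2 * n..<3 * n]), App ?R ([n..<2 * n] @ [2 * n..<3 * n])])
         (tuple_eq [0..<n] [n..<2 * n]))))) \<longleftrightarrow>
    (\<forall>\<xi>\<in>tuples (indiv M) n. \<forall>\<xi>'\<in>tuples (indiv M) n. \<forall>\<eta>\<in>tuples (indiv M) n.
      \<xi> \<in> g' A \<and> \<xi>' \<in> g' A \<and> \<eta> \<in> g' B \<and> \<xi> @ \<eta> \<in> g' ?R \<and> \<xi>' @ \<eta> \<in> g' ?R \<longrightarrow> \<xi> = \<xi>')" for g'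
    by (rule sat_injective) (use n in auto)
  show ?thesis
    unfolding lesssim_def Let_def sat.simps(4,11) functional injective
    by (simp only: all[OF sub(1)] all[OF sub(2)] inj[OF sub] pvar.sel
        fun_upd_same fun_upd_other[OF neq(1)] fun_upd_other[OF neq(2)])
qed

section \<open>What the Ackermann axioms demand of a structure\<close>

definition choice_graph :: "'a pred_structure \<Rightarrow> nat \<Rightarrow> ('a list \<Rightarrow> 'a list set) \<Rightarrow> 'a list set" where
  "choice_graph M r T = {\<xi> @ \<eta> | \<xi> \<eta>. \<xi> \<in> tuples (indiv M) r \<and> \<eta> \<in> T \<xi>}"

text \<open>Since \<xi> has the fixed length \<open>r\<close>, a concatenation splits in only one
  way.\<close>

lemma append_in_choice_graph:
  "\<xi> \<in> tuples (indiv M) r \<Longrightarrow> \<xi> @ \<eta> \<in> choice_graph M r T \<longleftrightarrow> \<eta> \<in> T \<xi>"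
  by (auto simp: choice_graph_def tuples_def)

text \<open>The graph codes a family of predicates as one relation and is the value intended for
  \<open>S\<close>. All axioms thus reduce to one task: whenever witnesses for \<open>D\<close>
  exist at every tuple, find a family of witnesses \<open>T\<close> whose graph is again a predicate
  of the structure.\<close>

lemma models_choice_h2I:
  fixes M :: "'a pred_structure"
  assumes choice: "\<And>H xs D f g. \<lbrakk>wf_fm H; distinct xs; psort D \<ge> 1; assignment M f g;
      \<forall>\<xi>\<in>tuples (indiv M) (length xs). \<exists>\<alpha>\<in>preds M (psort D). sat M (updates f xs \<xi>) (g(D := \<alpha>)) H\<rbrakk> \<Longrightarrow>
      \<exists>T. (\<forall>\<xi>\<in>tuples (indiv M) (length xs).
             T \<xi> \<in> preds M (psort D) \<and> sat M (updates f xs \<xi>) (g(D := T \<xi>)) H) \<and>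
          choice_graph M (length xs) T \<in> preds M (length xs + psort D)"
    and \<phi>: "\<phi> \<in> choice_h2"
  shows "models M \<phi>"
  unfolding models_def
proof (intro allI impI)
  fix f g
  assume asg: "assignment M f g"
  obtain xs ys D S H where \<phi>_eq: "\<phi> = ackermann_fm xs ys D S H"
    and len: "length ys = psort D" "psort D \<ge> 1" "length xs \<ge> 1" "psort S = length xs + psort D"
    and dist: "distinct (xs @ ys)" and H: "wf_fm H" and S: "S \<notin> free_pvars H"
    using \<phi> by (auto simp: choice_h2_def choice_h_def L2_def)
  \<comment> \<open>The sort of \<open>S\<close> exceeds that of \<open>D\<close> by
    \<open>length xs \<ge> 1\<close>.\<close>
  have DS: "D \<noteq> S" using len by auto
  show "sat M f g \<phi>"
  proof (cases "\<forall>\<xi>\<in>tuples (indiv M) (length xs). \<exists>\<alpha>\<in>preds M (psort D).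
      sat M (updates f xs \<xi>) (g(D := \<alpha>)) H")
    case False
    then show ?thesis using dist by (auto simp: \<phi>_eq ackermann_fm_def sat_alls)
  next
    case True
    from choice[OF H _ len(2) asg True] dist obtain T where
      T: "\<And>\<xi>. \<xi> \<in> tuples (indiv M) (length xs) \<Longrightarrow>
            T \<xi> \<in> preds M (psort D) \<and> sat M (updates f xs \<xi>) (g(D := T \<xi>)) H"
      and graph: "choice_graph M (length xs) T \<in> preds M (psort S)"
      using len by auto
    let ?\<sigma> = "choice_graph M (length xs) T"
    have "sat M f (g(S := ?\<sigma>)) (alls xs (ExP D
        (And (alls ys (Iff (App D ys) (App S (xs @ ys)))) H)))"
      unfolding sat_alls[OF dist[THEN distinct_append[THEN iffD1], THEN conjunct1]]
    proof
      fix \<xi> assume \<xi>: "\<xi> \<in> tuples (indiv M) (length xs)"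
      \<comment> \<open>\<open>S\<close> is not free in \<open>H\<close>, so giving it a value does
        not affect the truth of \<open>H\<close>.\<close>
      have "sat M (updates f xs \<xi>) (g(S := ?\<sigma>, D := T \<xi>)) H \<longleftrightarrow>
          sat M (updates f xs \<xi>) (g(D := T \<xi>)) H"
        by (rule sat_cong) (use S in auto)
      moreover have "sat M (updates f xs \<xi>) (g(S := ?\<sigma>, D := T \<xi>))
          (alls ys (Iff (App D ys) (App S (xs @ ys))))"
        using dist \<xi> DS
        by (auto simp: sat_alls map_updates map_updates_notin length_tuples
            append_in_choice_graph Int_commute)
      ultimately show "sat M (updates f xs \<xi>) (g(S := ?\<sigma>)) (ExP D
          (And (alls ys (Iff (App D ys) (App S (xs @ ys)))) H))"
        using T[OF \<xi>] by auto
    qed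
    with graph show ?thesis
      unfolding \<phi>_eq ackermann_fm_def by auto
  qed
qed

section \<open>Trichotomy as a sentence\<close>

lemma sat_TR:
  "sat M f g (TR n) \<longleftrightarrow> (\<forall>\<alpha>\<in>preds M n. \<forall>\<beta>\<in>preds M n.
    sat M f (g(PVar n 0 := \<alpha>, PVar n 1 := \<beta>)) (lesssim n (PVar n 0) (PVar n 1)) \<or>
    sat M f (g(PVar n 0 := \<alpha>, PVar n 1 := \<beta>)) (lesssim n (PVar n 1) (PVar n 0)))"
  by (simp add: TR_def Let_def)

lemma free_alls: "free_ivars (alls xs \<phi>) = free_ivars \<phi> - set xs" "free_pvars (alls xs \<phi>) = free_pvars \<phi>"
  "wf_fm (alls xs \<phi>) = wf_fm \<phi>"
  by (induction xs) (auto simp: alls_def)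

lemma free_exs: "free_ivars (exs xs \<phi>) = free_ivars \<phi> - set xs" "free_pvars (exs xs \<phi>) = free_pvars \<phi>"
  "wf_fm (exs xs \<phi>) = wf_fm \<phi>"
  by (induction xs) (auto simp: exs_def)

lemma free_conjs:
  assumes "\<phi>s \<noteq> []"
  shows "free_ivars (conjs \<phi>s) = (\<Union>\<phi>\<in>set \<phi>s. free_ivars \<phi>)"
    "free_pvars (conjs \<phi>s) = (\<Union>\<phi>\<in>set \<phi>s. free_pvars \<phi>)"
    "wf_fm (conjs \<phi>s) \<longleftrightarrow> (\<forall>\<phi>\<in>set \<phi>s. wf_fm \<phi>)"
  using assms by (induction \<phi>s rule: conjs.induct) auto

lemma free_tuple_eq:
  assumes "xs \<noteq> []" "length xs = length ys"
  shows "free_ivars (tuple_eq xs ys) \<subseteq> set xs \<union> set ys" "free_pvars (tuple_eq xs ys) = {}"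
    "wf_fm (tuple_eq xs ys)"
proof -
  have "map2 IEq xs ys \<noteq> []" using assms by (cases xs; cases ys) auto
  then show "free_ivars (tuple_eq xs ys) \<subseteq> set xs \<union> set ys" "free_pvars (tuple_eq xs ys) = {}"
    "wf_fm (tuple_eq xs ys)"
    using assms by (auto simp: tuple_eq_def free_conjs dest: set_zip_leftD set_zip_rightD)
qed

lemma sentence_TR:
  assumes "n \<ge> 1"
  shows "sentence (TR n)"
proof -
  \<comment> \<open>These bounds put the variables of both equations inside the blocks that the
    surrounding quantifiers bind.\<close>
  have "free_ivars (tuple_eq [3*n..<4*n] [2*n..<3*n]) \<subseteq> {2*n..<4*n}"
    "free_ivars (tuple_eq [0..<n] [n..<2*n]) \<subseteq> {0..<2*n}"
    using free_tuple_eq(1)[of "[3*n..<4*n]" "[2*n..<3*n]"] free_tuple_eq(1)[of "[0..<n]" "[n..<2*n]"] assms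
    by fastforce+
  then show ?thesis
    using assms
    by (auto simp: sentence_def TR_def lesssim_def Let_def free_alls free_exs free_conjs free_tuple_eq)
qed

text \<open>\<open>models\<close> quantifies over assignments and would hold vacuously if there were
  none; refuting a formula in a structure therefore needs one.\<close>

lemma ex_assignment:
  assumes "predicate_structure M"
  obtains f g where "assignment M f g"
proof -
  obtain a where "a \<in> indiv M" using assms by (auto simp: predicate_structure_def)
  moreover have "\<forall>P. psort P \<ge> 1 \<longrightarrow> (SOME \<alpha>. \<alpha> \<in> preds M (psort P)) \<in> preds M (psort P)"
    using assms by (auto simp: predicate_structure_def some_in_eq)
  ultimately have "assignment M (\<lambda>_. a) (\<lambda>P. SOME \<alpha>. \<alpha> \<in> preds M (psort P))"
    by (simp add: assignment_def)
  then show thesis by (rule that)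
qed


section \<open>The full structure over one individual\<close>

definition full_structure :: "'a set \<Rightarrow> 'a pred_structure" where
  "full_structure I = \<lparr>indiv = I, preds = \<lambda>n. Pow (tuples I n)\<rparr>"

lemma full_structure_simps [simp]:
  "indiv (full_structure I) = I" "preds (full_structure I) n = Pow (tuples I n)"
  by (simp_all add: full_structure_def)

lemma predicate_structure_full: "I \<noteq> {} \<Longrightarrow> predicate_structure (full_structure I)"
  by (auto simp: predicate_structure_def)

lemma henkin_asser_full: "I \<noteq> {} \<Longrightarrow> henkin_asser (full_structure I)"
  by (auto simp: henkin_asser_def predicate_structure_full)

text \<open>Choice in HOL picks the family of witnesses, and its graph is a predicate because the
  full structure contains every set of tuples.\<close>

lemma full_models_choice_h2:
  assumes "\<phi> \<in> choice_h2"
  shows "models (full_structure I) \<phi>"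
proof (rule models_choice_h2I[OF _ assms])
  let ?M = "full_structure I"
  fix H and xs :: "ivar list" and D f g
  assume "\<forall>\<xi>\<in>tuples (indiv ?M) (length xs). \<exists>\<alpha>\<in>preds ?M (psort D).
    sat ?M (updates f xs \<xi>) (g(D := \<alpha>)) H"
  then obtain T where T: "\<forall>\<xi>\<in>tuples (indiv ?M) (length xs). T \<xi> \<in> preds ?M (psort D) \<and>
      sat ?M (updates f xs \<xi>) (g(D := T \<xi>)) H"
    by metis
  then have "choice_graph ?M (length xs) T \<in> preds ?M (length xs + psort D)"
    by (fastforce simp: choice_graph_def tuples_def)
  with T show "\<exists>T. (\<forall>\<xi>\<in>tuples (indiv ?M) (length xs). T \<xi> \<in> preds ?M (psort D) \<and>
        sat ?M (updates f xs \<xi>) (g(D := T \<xi>)) H) \<and>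
      choice_graph ?M (length xs) T \<in> preds ?M (length xs + psort D)"
    by blast
qed

lemma tuples_singleton: "tuples {a} n = {replicate n a}"
  by (auto simp: tuples_def intro: replicate_eqI)

text \<open>There is only one \<open>n\<close>-tuple, so a predicate is empty or a singleton, and of
  two such predicates one is contained in the other.\<close>

lemma full_singleton_models_TR:
  assumes "n \<ge> 1"
  shows "models (full_structure {a}) (TR n)"
proof -
  let ?M = "full_structure {a}" and ?t = "replicate n a"
  have *: "sat ?M f g (lesssim n A B)" 
    if "psort A = n" "psort B = n" "g A = {} \<or> g B = {?t}" "g A \<subseteq> {?t}" "g B \<subseteq> {?t}" for f g A B
  proof (subst sat_lesssim)
    \<comment> \<open>This single pair serves both cases: nothing is required if \<open>A\<close> is
      empty, and otherwise \<open>B\<close> holds of the only tuple.\<close>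
    have "{?t @ ?t} \<in> preds ?M (2 * n)"
      by (auto simp: tuples_def)
    with that show "\<exists>R\<in>preds ?M (2 * n).
       (\<forall>\<xi>\<in>g A. \<exists>\<eta>\<in>g B. \<xi> @ \<eta> \<in> R \<and> (\<forall>\<zeta>\<in>g B. \<xi> @ \<zeta> \<in> R \<longrightarrow> \<zeta> = \<eta>)) \<and>
       (\<forall>\<xi>\<in>g A. \<forall>\<xi>'\<in>g A. \<forall>\<eta>\<in>g B. \<xi> @ \<eta> \<in> R \<longrightarrow> \<xi>' @ \<eta> \<in> R \<longrightarrow> \<xi> = \<xi>')"
      by (intro bexI[of _ "{?t @ ?t}"]) auto
  qed (use that assms in \<open>auto simp: tuples_singleton\<close>)
  show ?thesis
    unfolding models_def
    by (auto simp: sat_TR tuples_singleton subset_singleton_iff intro!: *)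
qed


section \<open>A permutation model with two kinds of individuals\<close>

definition cperm :: "('a \<Rightarrow> bool) \<Rightarrow> ('a \<Rightarrow> 'a) \<Rightarrow> bool" where
  "cperm c \<pi> \<longleftrightarrow> bij \<pi> \<and> (\<forall>x. c (\<pi> x) = c x)"

definition fixing :: "('a \<Rightarrow> bool) \<Rightarrow> 'a set \<Rightarrow> ('a \<Rightarrow> 'a) \<Rightarrow> bool" where
  "fixing c E \<pi> \<longleftrightarrow> cperm c \<pi> \<and> (\<forall>e\<in>E. \<pi> e = e)"

definition supports :: "('a \<Rightarrow> bool) \<Rightarrow> 'a set \<Rightarrow> 'a list set \<Rightarrow> bool" where
  "supports c E \<alpha> \<longleftrightarrow> (\<forall>\<pi>. fixing c E \<pi> \<longrightarrow> map \<pi> ` \<alpha> = \<alpha>)"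

text \<open>A permutation model of Fraenkel-Mostowski type; the support may vary with the predicate,
  so that finitely many parameters from the domain are allowed.\<close>

definition perm_model :: "('a \<Rightarrow> bool) \<Rightarrow> 'a pred_structure" where
  "perm_model c = \<lparr>indiv = UNIV,
     preds = \<lambda>n. {\<alpha>. \<alpha> \<subseteq> tuples UNIV n \<and> (\<exists>E. finite E \<and> supports c E \<alpha>)}\<rparr>"

lemma indiv_perm_model [simp]: "indiv (perm_model c) = UNIV"
  by (simp add: perm_model_def)

lemma preds_perm_model:
  "\<alpha> \<in> preds (perm_model c) n \<longleftrightarrow> \<alpha> \<subseteq> tuples UNIV n \<and> (\<exists>E. finite E \<and> supports c E \<alpha>)"
  by (simp add: perm_model_def)

section \<open>The group of colour-preserving permutations\<close>

lemma cperm_id: "cperm c id"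
  by (simp add: cperm_def)

lemma cperm_comp: "cperm c \<pi> \<Longrightarrow> cperm c \<rho> \<Longrightarrow> cperm c (\<pi> \<circ> \<rho>)"
  by (auto simp: cperm_def bij_comp)

lemma cperm_inv: "cperm c \<pi> \<Longrightarrow> cperm c (inv \<pi>)"
  unfolding cperm_def by (metis bij_imp_bij_inv bij_is_surj surj_f_inv_f)

lemma cperm_inv_simps [simp]:
  assumes "cperm c \<pi>"
  shows "inv \<pi> (\<pi> x) = x" "\<pi> (inv \<pi> x) = x" "inv \<pi> \<circ> \<pi> = id" "\<pi> \<circ> inv \<pi> = id"
  using assms by (auto simp: cperm_def bij_is_inj bij_is_surj surj_f_inv_f surj_iff)

lemma fixing_inv: "fixing c E \<pi> \<Longrightarrow> fixing c E (inv \<pi>)"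
  unfolding fixing_def by (metis cperm_inv cperm_inv_simps(1))

lemma fixing_comp: "fixing c E \<pi> \<Longrightarrow> fixing c E \<rho> \<Longrightarrow> fixing c E (\<pi> \<circ> \<rho>)"
  by (auto simp: fixing_def cperm_comp)

lemma fixing_cperm: "fixing c E \<pi> \<Longrightarrow> cperm c \<pi>"
  by (simp add: fixing_def)

lemma fixing_mono: "fixing c E \<pi> \<Longrightarrow> F \<subseteq> E \<Longrightarrow> fixing c F \<pi>"
  by (auto simp: fixing_def)

lemma fixing_transpose: "c a = c b \<Longrightarrow> a \<notin> E \<Longrightarrow> b \<notin> E \<Longrightarrow> fixing c E (transpose a b)"
  by (auto simp: fixing_def cperm_def transpose_def)

section \<open>Supports and their transport\<close>

lemma supports_mono: "supports c E \<alpha> \<Longrightarrow> E \<subseteq> F \<Longrightarrow> supports c F \<alpha>"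
  by (auto simp: supports_def fixing_def)

text \<open>The inverse of a permutation fixing \<open>E\<close> also fixes \<open>E\<close>, so
  closure under these permutations already gives equality of the set and its image.\<close>

lemma supportsI:
  assumes "\<And>\<pi> \<xi>. fixing c E \<pi> \<Longrightarrow> \<xi> \<in> \<alpha> \<Longrightarrow> map \<pi> \<xi> \<in> \<alpha>"
  shows "supports c E \<alpha>"
  unfolding supports_def
proof (intro allI impI equalityI subsetI)
  fix \<pi> \<xi>
  assume \<pi>: "fixing c E \<pi>" and "\<xi> \<in> \<alpha>"
  then have "map (inv \<pi>) \<xi> \<in> \<alpha>" using assms fixing_inv by blast
  moreover have "\<xi> = map \<pi> (map (inv \<pi>) \<xi>)" using fixing_cperm[OF \<pi>] by simp
  ultimately show "\<xi> \<in> map \<pi> ` \<alpha>" by blast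
qed (use assms in blast)

text \<open>Conjugation: if \<rho> fixes the image of \<open>E\<close> pointwise, then
  \<open>inv \<pi> \<circ> \<rho> \<circ> \<pi>\<close> fixes \<open>E\<close> pointwise.\<close>

lemma supports_image:
  assumes "supports c E \<alpha>" "cperm c \<pi>"
  shows "supports c (\<pi> ` E) (map \<pi> ` \<alpha>)"
proof (rule supportsI)
  fix \<rho> \<xi>
  assume \<rho>: "fixing c (\<pi> ` E) \<rho>" and "\<xi> \<in> map \<pi> ` \<alpha>"
  then obtain \<eta> where \<eta>: "\<eta> \<in> \<alpha>" "\<xi> = map \<pi> \<eta>" by blast
  have "fixing c E (inv \<pi> \<circ> \<rho> \<circ> \<pi>)"
    using \<rho> assms(2) by (auto simp: fixing_def intro: cperm_comp cperm_inv)
  then have "map (inv \<pi> \<circ> \<rho> \<circ> \<pi>) \<eta> \<in> \<alpha>"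
    using assms(1) \<eta> by (auto simp: supports_def)
  moreover have "map \<rho> \<xi> = map \<pi> (map (inv \<pi> \<circ> \<rho> \<circ> \<pi>) \<eta>)"
    using assms(2) \<eta> by simp
  ultimately show "map \<rho> \<xi> \<in> map \<pi> ` \<alpha>" by blast
qed

text \<open>The quotient \<open>inv \<rho> \<circ> \<pi>\<close> fixes the support. A transported
  predicate thus depends only on where its support goes, which later makes transport along an orbit
  well defined.\<close>

lemma supports_image_cong:
  assumes E: "supports c E \<alpha>" and perms: "cperm c \<pi>" "cperm c \<rho>" and eq: "\<And>e. e \<in> E \<Longrightarrow> \<pi> e = \<rho> e"
  shows "map \<pi> ` \<alpha> = map \<rho> ` \<alpha>"
proof -
  have "fixing c E (inv \<rho> \<circ> \<pi>)"
    using perms eq by (auto simp: fixing_def intro: cperm_comp cperm_inv)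
  then have "map (inv \<rho> \<circ> \<pi>) ` \<alpha> = \<alpha>" using E by (simp add: supports_def)
  then have "map \<rho> ` map (inv \<rho> \<circ> \<pi>) ` \<alpha> = map \<rho> ` \<alpha>" by simp
  moreover have "\<rho> \<circ> (inv \<rho> \<circ> \<pi>) = \<pi>" using perms by (simp add: fun_eq_iff)
  ultimately show ?thesis by (simp add: image_image)
qed

section \<open>Invariance of truth under permutations\<close>

lemma preds_perm_model_image:
  assumes "cperm c \<pi>" "\<alpha> \<in> preds (perm_model c) n"
  shows "map \<pi> ` \<alpha> \<in> preds (perm_model c) n"
proof -
  from assms(2) obtain E where "\<alpha> \<subseteq> tuples UNIV n" "finite E" "supports c E \<alpha>"
    by (auto simp: preds_perm_model)
  then have "map \<pi> ` \<alpha> \<subseteq> tuples UNIV n" "finite (\<pi> ` E)" "supports c (\<pi> ` E) (map \<pi> ` \<alpha>)"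
    using assms(1) by (auto simp: tuples_def supports_image)
  then show ?thesis unfolding preds_perm_model by blast
qed

text \<open>\<pi> permutes the predicates of each sort, with inverse induced by
  \<open>inv \<pi>\<close>, so a predicate quantifier may be reindexed along it.\<close>

lemma ball_preds_perm_model_image:
  assumes "cperm c \<pi>"
  shows "(\<forall>\<alpha>\<in>preds (perm_model c) n. P \<alpha>) \<longleftrightarrow> (\<forall>\<alpha>\<in>preds (perm_model c) n. P (map \<pi> ` \<alpha>))"
proof (intro iffI ballI)
  fix \<alpha>
  assume R: "\<forall>\<alpha>\<in>preds (perm_model c) n. P (map \<pi> ` \<alpha>)" and "\<alpha> \<in> preds (perm_model c) n"
  then have "P (map \<pi> ` map (inv \<pi>) ` \<alpha>)"
    using preds_perm_model_image cperm_inv assms by blast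
  then show "P \<alpha>" using assms by (simp add: image_image)
qed (use preds_perm_model_image[OF assms] in blast)

text \<open>A colour-preserving permutation is an automorphism of the structure: at each quantifier
  the range is reindexed by \<pi> and the update is absorbed into the transported
  assignment.\<close>

lemma sat_perm_model_invariant:
  assumes \<pi>: "cperm c \<pi>"
  shows "sat (perm_model c) (\<pi> \<circ> f) (\<lambda>P. map \<pi> ` g P) \<phi> \<longleftrightarrow> sat (perm_model c) f g \<phi>"
proof (induction \<phi> arbitrary: f g)
  case (IEq x y)
  show ?case using cperm_inv_simps(1)[OF \<pi>] by simp metis
next
  case (App P xs)
  have "inj (map \<pi>)" using \<pi> by (simp add: cperm_def bij_is_inj)
  then have "map \<pi> (map f xs) \<in> map \<pi> ` g P \<longleftrightarrow> map f xs \<in> g P" by (rule inj_image_mem_iff)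
  then show ?case by (simp only: sat.simps map_map)
next
  have upd: "(\<pi> \<circ> f)(x := \<pi> a) = \<pi> \<circ> f(x := a)" for f :: "ivar \<Rightarrow> 'a" and x a by auto
  have all: "(\<forall>a. Q a) \<longleftrightarrow> (\<forall>a. Q (\<pi> a))" for Q by (metis cperm_inv_simps(2)[OF \<pi>])
  {
    case (AllI x \<phi>)
    show ?case unfolding sat.simps indiv_perm_model ball_UNIV
      by (subst all) (simp only: upd AllI.IH)
  next
    case (ExI x \<phi>)
    have ex: "(\<exists>a. Q a) \<longleftrightarrow> (\<exists>a. Q (\<pi> a))" for Q by (metis cperm_inv_simps(2)[OF \<pi>])
    show ?case unfolding sat.simps indiv_perm_model bex_UNIV
      by (subst ex) (simp only: upd ExI.IH)
  }
next
  have upd: "(\<lambda>Q. map \<pi> ` g Q)(P := map \<pi> ` \<alpha>) = (\<lambda>Q. map \<pi> ` (g(P := \<alpha>)) Q)"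
    for g :: "pvar \<Rightarrow> 'a list set" and P \<alpha> by (simp add: fun_eq_iff)
  {
    case (AllP P \<phi>)
    show ?case unfolding sat.simps
      by (subst ball_preds_perm_model_image[OF \<pi>]) (simp only: upd AllP.IH)
  next
    case (ExP P \<phi>)
    have ex: "(\<exists>\<alpha>\<in>preds (perm_model c) n. Q \<alpha>) \<longleftrightarrow> (\<exists>\<alpha>\<in>preds (perm_model c) n. Q (map \<pi> ` \<alpha>))"
      for n Q
      using ball_preds_perm_model_image[OF \<pi>, of n "\<lambda>\<alpha>. \<not> Q \<alpha>"] by blast
    show ?case unfolding sat.simps by (subst ex) (simp only: upd ExP.IH)
  }
qed auto

text \<open>\<open>H\<close> has finitely many parameters. A permutation that fixes the individual
  ones and the supports of the predicate ones leaves them all unchanged, so transporting the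
  assignment moves only the tuple and the value of \<open>D\<close>.\<close>

lemma sat_perm_model_supported:
  assumes H: "wf_fm H" and asg: "assignment (perm_model c) f g"
  obtains E where "finite E"
    "\<And>\<pi> \<xi> \<alpha>. fixing c E \<pi> \<Longrightarrow>
      sat (perm_model c) (updates f xs (map \<pi> \<xi>)) (g(D := map \<pi> ` \<alpha>)) H \<longleftrightarrow>
      sat (perm_model c) (updates f xs \<xi>) (g(D := \<alpha>)) H"
proof -
  have "\<forall>P\<in>free_pvars H. \<exists>E. finite E \<and> supports c E (g P)"
    using asg wf_fm_psort_pos[OF H] by (auto simp: assignment_def preds_perm_model)
  then obtain E where E: "\<And>P. P \<in> free_pvars H \<Longrightarrow> finite (E P) \<and> supports c (E P) (g P)"
    by metis
  let ?E = "f ` free_ivars H \<union> \<Union> (E ` free_pvars H)"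
  have "sat (perm_model c) (updates f xs (map \<pi> \<xi>)) (g(D := map \<pi> ` \<alpha>)) H \<longleftrightarrow>
      sat (perm_model c) (updates f xs \<xi>) (g(D := \<alpha>)) H" (is "?L \<longleftrightarrow> ?R")
    if \<pi>: "fixing c ?E \<pi>" for \<pi> \<xi> \<alpha>
  proof -
    have "?L \<longleftrightarrow> sat (perm_model c) (\<pi> \<circ> updates f xs \<xi>) (\<lambda>P. map \<pi> ` (g(D := \<alpha>)) P) H"
    proof (rule sat_cong)
      fix x assume "x \<in> free_ivars H"
      then have "\<pi> (f x) = f x" using \<pi> by (simp add: fixing_def)
      then show "updates f xs (map \<pi> \<xi>) x = (\<pi> \<circ> updates f xs \<xi>) x"
        unfolding comp_updates by (simp add: updates_def split: option.splits)
    next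
      fix P assume P: "P \<in> free_pvars H"
      then have "fixing c (E P) \<pi>" using fixing_mono[OF \<pi>] by blast
      then show "(g(D := map \<pi> ` \<alpha>)) P = map \<pi> ` (g(D := \<alpha>)) P"
        using E[OF P] by (auto simp: supports_def)
    qed
    also have "\<dots> \<longleftrightarrow> ?R"
      by (rule sat_perm_model_invariant[OF fixing_cperm[OF \<pi>]])
    finally show ?thesis .
  qed
  moreover have "finite ?E" using E by auto
  ultimately show thesis using that by blast
qed

section \<open>Full comprehension in the permutation model\<close>

lemma predicate_structure_perm_model: "predicate_structure (perm_model c)"
proof -
  have "{} \<in> preds (perm_model c) n" for n
    by (auto simp: preds_perm_model supports_def)
  then have "preds (perm_model c) n \<noteq> {}" for n by blast
  then show ?thesis by (auto simp: predicate_structure_def preds_perm_model)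
qed

lemma henkin_asser_perm_model: "henkin_asser (perm_model c)"
  unfolding henkin_asser_def
proof (intro conjI allI impI predicate_structure_perm_model)
  fix H and xs :: "ivar list" and f g
  assume *: "wf_fm H \<and> xs \<noteq> [] \<and> distinct xs \<and> assignment (perm_model c) f g"
  let ?X = "{\<xi> \<in> tuples (indiv (perm_model c)) (length xs). sat (perm_model c) (updates f xs \<xi>) g H}"
  \<comment> \<open>A dummy for \<open>D\<close>: a variable of sort 0 is not free in the
    well-formed \<open>H\<close>, so its value is irrelevant and only the tuple moves.\<close>
  let ?D = "PVar 0 0"
  have irrelevant: "sat (perm_model c) f' (g(?D := \<alpha>)) H \<longleftrightarrow> sat (perm_model c) f' g H" for f' \<alpha>
    by (rule sat_cong) (use wf_fm_psort_pos[of H ?D] * in auto)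
  obtain E where "finite E" "\<And>\<pi> \<xi> \<alpha>. fixing c E \<pi> \<Longrightarrow>
      sat (perm_model c) (updates f xs (map \<pi> \<xi>)) (g(?D := map \<pi> ` \<alpha>)) H \<longleftrightarrow>
      sat (perm_model c) (updates f xs \<xi>) (g(?D := \<alpha>)) H"
    using sat_perm_model_supported[of H c f g xs ?D] * by metis
  then have "supports c E ?X"
    by (intro supportsI) (auto simp: irrelevant tuples_def)
  with \<open>finite E\<close> show "?X \<in> preds (perm_model c) (length xs)"
    by (auto simp: preds_perm_model)
qed


section \<open>Choice in the permutation model\<close>

text \<open>One point at a time: if \<pi> is right on \<open>X\<close>, follow it by the
  transposition of \<open>\<pi> x\<close> and \<open>h x\<close>. These have the same colour, and by
  injectivity no \<open>h y\<close> with \<open>y \<in> X\<close> is either of them, so the earlier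
  values stay.\<close>

lemma extend_to_cperm:
  assumes "finite X" "inj_on h X" "\<And>x. x \<in> X \<Longrightarrow> c (h x) = c x"
  obtains \<pi> where "cperm c \<pi>" "\<And>x. x \<in> X \<Longrightarrow> \<pi> x = h x"
  using assms
proof (induction X arbitrary: thesis rule: finite_induct)
  case empty
  then show ?case using cperm_id by blast
next
  case (insert x X)
  obtain \<pi> where \<pi>: "cperm c \<pi>" "\<And>x. x \<in> X \<Longrightarrow> \<pi> x = h x"
    by (rule insert.IH) (use insert.prems in auto)
  let ?\<rho> = "transpose (\<pi> x) (h x) \<circ> \<pi>"
  have "c (\<pi> x) = c (h x)" using \<pi> insert.prems by (auto simp: cperm_def)
  then have "cperm c (transpose (\<pi> x) (h x))"
    by (auto simp: cperm_def transpose_def)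
  then have "cperm c ?\<rho>" using \<pi> cperm_comp by blast
  moreover have "?\<rho> y = h y" if "y \<in> insert x X" for y
  proof (cases "y = x")
    case False
    with that have "y \<in> X" by simp
    moreover have "\<pi> y \<noteq> \<pi> x" using False \<pi>(1) by (metis cperm_inv_simps(1))
    moreover have "h y \<noteq> h x" using False that insert.prems(2) by (auto simp: inj_on_def)
    ultimately show ?thesis using \<pi> by (simp add: transpose_def)
  qed simp
  ultimately show ?case using insert.prems(1) by blast
qed

text \<open>Map \<open>X\<close> identically and \<open>Y\<close> into \<open>Z\<close> colour by
  colour; the cardinality bound leaves room in each colour, and the resulting finite injection
  extends to a permutation.\<close>

lemma move_into_reservoir:
  fixes c :: "'a \<Rightarrow> bool"
  assumes fin: "finite X" "finite Y" "finite Z" and disj: "X \<inter> Y = {}" "X \<inter> Z = {}"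
    and card: "\<And>b. card Y \<le> card {z \<in> Z. c z = b}"
  obtains \<pi> where "fixing c X \<pi>" "\<pi> ` Y \<subseteq> Z"
proof -
  have "\<exists>j. inj_on j {y \<in> Y. c y = b} \<and> j ` {y \<in> Y. c y = b} \<subseteq> {z \<in> Z. c z = b}" for b
  proof -
    have "card {y \<in> Y. c y = b} \<le> card Y" using fin by (intro card_mono) auto
    also have "\<dots> \<le> card {z \<in> Z. c z = b}" by (rule card)
    finally show ?thesis using fin by (auto intro: card_le_inj[simplified conj_commute])
  qed
  then obtain j where j: "\<And>b. inj_on (j b) {y \<in> Y. c y = b}"
    "\<And>b y. y \<in> Y \<Longrightarrow> c y = b \<Longrightarrow> j b y \<in> Z \<and> c (j b y) = b"
    by (simp add: image_subset_iff) metis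
  define h where "h x = (if x \<in> X then x else j (c x) x)" for x
  \<comment> \<open>Values from \<open>Y\<close> lie in \<open>Z\<close>, hence off
    \<open>X\<close>, and keep their colour, so a clash could only occur within one colour of
    \<open>Y\<close>.\<close>
  have "inj_on h (X \<union> Y)"
  proof (rule inj_onI)
    fix x y assume xy: "x \<in> X \<union> Y" "y \<in> X \<union> Y" "h x = h y"
    show "x = y"
    proof (cases "x \<in> X \<or> y \<in> X")
      case True
      then show ?thesis using xy disj j(2) by (auto simp: h_def split: if_splits)
    next
      case False
      then have "x \<in> Y" "y \<in> Y" "j (c x) x = j (c y) y" using xy by (auto simp: h_def)
      moreover from this have "c x = c y" using j(2) by metis
      ultimately show ?thesis using j(1)[of "c x"] by (auto simp: inj_on_def)
    qed
  qed
  moreover have "c (h x) = c x" if "x \<in> X \<union> Y" for x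
    using that j(2) by (auto simp: h_def)
  ultimately obtain \<pi> where \<pi>: "cperm c \<pi>" "\<And>x. x \<in> X \<union> Y \<Longrightarrow> \<pi> x = h x"
    using extend_to_cperm[of "X \<union> Y" h c] fin by blast
  have "fixing c X \<pi>" using \<pi> by (auto simp: fixing_def h_def)
  moreover have "\<pi> ` Y \<subseteq> Z" using \<pi>(2) j(2) disj by (auto simp: h_def)
  ultimately show thesis by (rule that)
qed

lemma ex_reservoir:
  fixes c :: "'a \<Rightarrow> bool"
  assumes inf: "\<And>b. infinite {x. c x = b}" and "finite X"
  obtains Z where "finite Z" "X \<inter> Z = {}" "\<And>b. k \<le> card {z \<in> Z. c z = b}"
proof -
  have "\<exists>B. finite B \<and> card B = k \<and> B \<subseteq> {x. c x = b} - X" for b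
    using inf[of b] \<open>finite X\<close> by (intro infinite_arbitrarily_large) simp
  then obtain B where B: "\<And>b. finite (B b)" "\<And>b. card (B b) = k" "\<And>b. B b \<subseteq> {x. c x = b} - X"
    by metis
  let ?Z = "B True \<union> B False"
  have "k \<le> card {z \<in> ?Z. c z = b}" for b
  proof -
    have "B b \<subseteq> {z \<in> ?Z. c z = b}" using B(3)[of b] by (cases b) auto
    then have "card (B b) \<le> card {z \<in> ?Z. c z = b}" using B(1) by (intro card_mono) auto
    then show ?thesis using B(2) by simp
  qed
  moreover have "finite ?Z" "X \<inter> ?Z = {}" using B(1,3) by fastforce+
  ultimately show thesis using that by blast
qed

text \<open>The supports of the witnesses are bounded in size because the tuples fall into finitely many
  orbits; each support can then be moved, off the tuple itself, into one sufficiently large finite set.\<close>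

lemma uniform_support:
  assumes inf: "\<And>b. infinite {x. c x = b}" and F: "finite F"
    and inv: "\<And>\<pi> \<xi> \<alpha>. fixing c F \<pi> \<Longrightarrow> Q (map \<pi> \<xi>) (map \<pi> ` \<alpha>) \<longleftrightarrow> Q \<xi> \<alpha>"
    and ex: "\<And>\<xi>. \<xi> \<in> tuples UNIV r \<Longrightarrow> \<exists>\<alpha>\<in>preds (perm_model c) m. Q \<xi> \<alpha>"
  obtains E where "finite E" "F \<subseteq> E"
    "\<And>\<xi>. \<xi> \<in> tuples UNIV r \<Longrightarrow> \<exists>\<alpha>\<in>preds (perm_model c) m. Q \<xi> \<alpha> \<and> supports c (E \<union> set \<xi>) \<alpha>"
proof -
  \<comment> \<open>Enough points of each colour off \<open>F\<close> to receive any
    \<open>r\<close>-tuple; the finite set \<open>W\<close> of tuples over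
    \<open>F \<union> Z\<close> then meets every orbit under permutations fixing
    \<open>F\<close>.\<close>
  obtain Z where Z: "finite Z" "F \<inter> Z = {}" "\<And>b. r \<le> card {z \<in> Z. c z = b}"
    using ex_reservoir[OF inf F, of r] by blast
  define W where "W = {\<xi>. set \<xi> \<subseteq> F \<union> Z \<and> length \<xi> = r}"
  have finW: "finite W" unfolding W_def using F Z by (intro finite_lists_length_eq) auto
  have "\<forall>\<xi>\<in>W. \<exists>\<alpha> E. \<alpha> \<in> preds (perm_model c) m \<and> Q \<xi> \<alpha> \<and> finite E \<and> supports c E \<alpha>"
  proof
    fix \<xi> assume "\<xi> \<in> W"
    then have "\<xi> \<in> tuples UNIV r" by (simp add: W_def tuples_def)
    from ex[OF this] obtain \<alpha> where \<alpha>: "\<alpha> \<in> preds (perm_model c) m" "Q \<xi> \<alpha>" by blast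
    moreover from \<alpha>(1) obtain E where "finite E" "supports c E \<alpha>"
      unfolding preds_perm_model by blast
    ultimately show "\<exists>\<alpha> E. \<alpha> \<in> preds (perm_model c) m \<and> Q \<xi> \<alpha> \<and> finite E \<and> supports c E \<alpha>"
      by blast
  qed
  then obtain A E where A: "\<And>\<xi>. \<xi> \<in> W \<Longrightarrow>
      A \<xi> \<in> preds (perm_model c) m \<and> Q \<xi> (A \<xi>) \<and> finite (E \<xi>) \<and> supports c (E \<xi>) (A \<xi>)"
    by metis
  let ?E0 = "\<Union> (E ` W)"
  have finE0: "finite ?E0" using A finW by blast
  let ?k = "card ?E0"
  \<comment> \<open>Room for \<open>?k\<close> points of a support even after discarding the at most
    \<open>r\<close> entries of a tuple.\<close>
  obtain Z' where Z': "finite Z'" "F \<inter> Z' = {}" "\<And>b. ?k + r \<le> card {z \<in> Z'. c z = b}"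
    using ex_reservoir[OF inf F, of "?k + r"] by blast
  have "\<exists>\<alpha>\<in>preds (perm_model c) m. Q \<xi> \<alpha> \<and> supports c (F \<union> Z' \<union> set \<xi>) \<alpha>"
    if \<xi>: "\<xi> \<in> tuples UNIV r" for \<xi>
  proof -
    have len: "length \<xi> = r" using \<xi> by (simp add: tuples_def)
    have card_\<xi>: "card (set \<xi>) \<le> r" using len card_length by blast
    have "card (set \<xi> - F) \<le> card (set \<xi>)" by (intro card_mono) auto
    then have le: "card (set \<xi> - F) \<le> card {z \<in> Z. c z = b}" for b
      using card_\<xi> Z(3)[of b] by linarith
    obtain \<pi> where \<pi>: "fixing c F \<pi>" "\<pi> ` (set \<xi> - F) \<subseteq> Z"
      by (rule move_into_reservoir[of F "set \<xi> - F" Z c]) (use F Z le in auto)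
    have cp: "cperm c \<pi>" using \<pi>(1) by (rule fixing_cperm)
    have "\<pi> x \<in> F \<union> Z" if "x \<in> set \<xi>" for x
      using \<pi> that by (cases "x \<in> F") (auto simp: fixing_def)
    then have W: "map \<pi> \<xi> \<in> W" using len by (auto simp: W_def)
    note A\<pi> = A[OF W]
    \<comment> \<open>The witness at the moved tuple, pulled back to \<xi>; it is supported by
      \<open>?D\<close>, which has at most \<open>?k\<close> points.\<close>
    let ?\<beta> = "map (inv \<pi>) ` A (map \<pi> \<xi>)" and ?D = "inv \<pi> ` ?E0"
    have \<beta>: "?\<beta> \<in> preds (perm_model c) m"
      using A\<pi> cp by (auto intro: preds_perm_model_image cperm_inv)
    have "Q \<xi> ?\<beta>"
      using inv[OF \<pi>(1), of \<xi> ?\<beta>] A\<pi> cp by (simp add: image_image)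
    have "supports c ?D ?\<beta>"
    proof (intro supports_image cperm_inv cp)
      show "supports c ?E0 (A (map \<pi> \<xi>))"
        by (rule supports_mono[of c "E (map \<pi> \<xi>)"]) (use A\<pi> W in blast)+
    qed
    have "card (?D - (F \<union> set \<xi>)) \<le> card ?D"
      by (rule card_mono[OF finite_imageI[OF finE0] Diff_subset])
    then have cardD: "card (?D - (F \<union> set \<xi>)) \<le> ?k"
      using card_image_le[OF finE0, of "inv \<pi>"] by linarith
    have le': "card (?D - (F \<union> set \<xi>)) \<le> card {z \<in> Z' - set \<xi>. c z = b}" for b
    proof -
      have "{z \<in> Z' - set \<xi>. c z = b} = {z \<in> Z'. c z = b} - set \<xi>" by auto
      then have "card {z \<in> Z'. c z = b} - card (set \<xi>) \<le> card {z \<in> Z' - set \<xi>. c z = b}"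
        by (simp add: diff_card_le_card_Diff)
      then show ?thesis using cardD Z'(3)[of b] card_\<xi> by linarith
    qed
    \<comment> \<open>Fixing \<open>F\<close> and the entries of \<xi> preserves \<open>Q\<close>
      and the tuple itself, while the rest of the support enters the uniform set
      \<open>Z'\<close>.\<close>
    obtain \<rho> where \<rho>: "fixing c (F \<union> set \<xi>) \<rho>" "\<rho> ` (?D - (F \<union> set \<xi>)) \<subseteq> Z' - set \<xi>"
      by (rule move_into_reservoir[of "F \<union> set \<xi>" "?D - (F \<union> set \<xi>)" "Z' - set \<xi>" c, OF _ _ _ _ _ le'])
        (use F finE0 Z'(1,2) in auto)
    have "\<rho> ` ?D \<subseteq> F \<union> Z' \<union> set \<xi>"
    proof
      fix y assume "y \<in> \<rho> ` ?D"
      then obtain x where x: "x \<in> ?D" "y = \<rho> x" by blast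
      show "y \<in> F \<union> Z' \<union> set \<xi>"
        using x \<rho> by (cases "x \<in> F \<union> set \<xi>") (auto simp: fixing_def)
    qed
    then have "supports c (F \<union> Z' \<union> set \<xi>) (map \<rho> ` ?\<beta>)"
      using supports_image[OF \<open>supports c ?D ?\<beta>\<close> fixing_cperm[OF \<rho>(1)]] by (rule supports_mono[rotated])
    moreover have "map \<rho> \<xi> = \<xi>" using \<rho>(1) by (auto simp: fixing_def intro: map_idI)
    then have "Q \<xi> (map \<rho> ` ?\<beta>)"
      using inv[OF fixing_mono[OF \<rho>(1)], of \<xi> ?\<beta>] \<open>Q \<xi> ?\<beta>\<close> by simp
    moreover have "map \<rho> ` ?\<beta> \<in> preds (perm_model c) m"
      using \<beta> fixing_cperm[OF \<rho>(1)] by (rule preds_perm_model_image[rotated])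
    ultimately show ?thesis by blast
  qed
  moreover have "finite (F \<union> Z')" using F Z' by simp
  ultimately show thesis using that[of "F \<union> Z'"] by blast
qed

text \<open>The transported witness does not depend on the permutation chosen: any two that carry
  the representative to the same tuple agree on \<open>E\<close> and on its entries, hence on the
  support of the witness.\<close>

lemma equivariant_choice:
  fixes c :: "'a \<Rightarrow> bool"
  assumes inv: "\<And>\<pi> \<xi> \<alpha>. fixing c E \<pi> \<Longrightarrow> Q (map \<pi> \<xi>) (map \<pi> ` \<alpha>) \<longleftrightarrow> Q \<xi> \<alpha>"
    and ex: "\<And>\<xi>. \<xi> \<in> tuples UNIV r \<Longrightarrow>
      \<exists>\<alpha>\<in>preds (perm_model c) m. Q \<xi> \<alpha> \<and> supports c (E \<union> set \<xi>) \<alpha>"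
  obtains T where
    "\<And>\<xi>. \<xi> \<in> tuples UNIV r \<Longrightarrow> T \<xi> \<in> preds (perm_model c) m \<and> Q \<xi> (T \<xi>)"
    "\<And>\<pi> \<xi>. fixing c E \<pi> \<Longrightarrow> \<xi> \<in> tuples UNIV r \<Longrightarrow> T (map \<pi> \<xi>) = map \<pi> ` T \<xi>"
proof -
  obtain A where A: "\<And>\<xi>. \<xi> \<in> tuples UNIV r \<Longrightarrow>
      A \<xi> \<in> preds (perm_model c) m \<and> Q \<xi> (A \<xi>) \<and> supports c (E \<union> set \<xi>) (A \<xi>)"
    using ex by metis
  define orbit where "orbit \<xi> = {\<zeta>. \<exists>\<pi>. fixing c E \<pi> \<and> map \<pi> \<zeta> = \<xi>}" for \<xi>
  \<comment> \<open>The orbit is the same set for all its members, so \<open>SOME\<close> returns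
    one representative for all of them.\<close>
  define rep where "rep \<xi> = (SOME \<zeta>. \<zeta> \<in> orbit \<xi>)" for \<xi>
  define s where "s \<xi> = (SOME \<pi>. fixing c E \<pi> \<and> map \<pi> (rep \<xi>) = \<xi>)" for \<xi>
  define T where "T \<xi> = map (s \<xi>) ` A (rep \<xi>)" for \<xi>
  have "\<xi> \<in> orbit \<xi>" for \<xi>
    unfolding orbit_def by (auto intro!: exI[of _ id] simp: fixing_def cperm_id)
  then have "rep \<xi> \<in> orbit \<xi>" for \<xi> unfolding rep_def by (rule someI)
  then have "\<exists>\<pi>. fixing c E \<pi> \<and> map \<pi> (rep \<xi>) = \<xi>" for \<xi> by (simp add: orbit_def)
  then have s: "fixing c E (s \<xi>) \<and> map (s \<xi>) (rep \<xi>) = \<xi>" for \<xi>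
    unfolding s_def by (rule someI_ex)
  have rep_tuples: "rep \<xi> \<in> tuples UNIV r" if "\<xi> \<in> tuples UNIV r" for \<xi>
    using s[of \<xi>] that by (auto simp: tuples_def dest: arg_cong[of _ _ length])
  have orbit_subset: "orbit \<xi> \<subseteq> orbit (map \<pi> \<xi>)" if "fixing c E \<pi>" for \<pi> \<xi>
    unfolding orbit_def using fixing_comp[OF that] by fastforce
  have orbit_eq: "orbit (map \<pi> \<xi>) = orbit \<xi>" if \<pi>: "fixing c E \<pi>" for \<pi> \<xi>
    using orbit_subset[OF \<pi>, of \<xi>] orbit_subset[OF fixing_inv[OF \<pi>], of "map \<pi> \<xi>"] fixing_cperm[OF \<pi>]
    by simp
  show thesis
  proof
    fix \<xi> :: "'a list" assume "\<xi> \<in> tuples UNIV r"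
    note A' = A[OF rep_tuples[OF this]]
    have "Q (map (s \<xi>) (rep \<xi>)) (T \<xi>)"
      unfolding T_def using inv s A' by blast
    moreover have "T \<xi> \<in> preds (perm_model c) m"
      unfolding T_def using preds_perm_model_image fixing_cperm s A' by blast
    ultimately show "T \<xi> \<in> preds (perm_model c) m \<and> Q \<xi> (T \<xi>)" using s by simp
  next
    fix \<pi> and \<xi> :: "'a list" assume \<pi>: "fixing c E \<pi>" and \<xi>: "\<xi> \<in> tuples UNIV r"
    have rep_eq: "rep (map \<pi> \<xi>) = rep \<xi>" by (simp add: rep_def orbit_eq[OF \<pi>])
    \<comment> \<open>Both permutations carry the common representative to
      \<open>map \<pi> \<xi>\<close>.\<close>
    have "map (s (map \<pi> \<xi>)) (rep \<xi>) = map (\<pi> \<circ> s \<xi>) (rep \<xi>)"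
      using s[of "map \<pi> \<xi>"] s[of \<xi>] by (simp add: rep_eq flip: map_map)
    then have "map (s (map \<pi> \<xi>)) ` A (rep \<xi>) = map (\<pi> \<circ> s \<xi>) ` A (rep \<xi>)"
      using s \<pi> A[OF rep_tuples[OF \<xi>]]
      by (intro supports_image_cong[of c "E \<union> set (rep \<xi>)"])
        (auto simp: fixing_def intro: cperm_comp)
    then show "T (map \<pi> \<xi>) = map \<pi> ` T \<xi>"
      by (simp add: T_def rep_eq image_image)
  qed
qed

lemma perm_model_models_choice_h2:
  assumes inf: "\<And>b. infinite {x. c x = b}" and \<phi>: "\<phi> \<in> choice_h2"
  shows "models (perm_model c) \<phi>"
proof (rule models_choice_h2I[OF _ \<phi>])
  let ?M = "perm_model c"
  fix H and xs :: "ivar list" and D f g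
  assume H: "wf_fm H" and asg: "assignment ?M f g"
    and ex: "\<forall>\<xi>\<in>tuples (indiv ?M) (length xs). \<exists>\<alpha>\<in>preds ?M (psort D).
      sat ?M (updates f xs \<xi>) (g(D := \<alpha>)) H"
  define Q where "Q \<xi> \<alpha> \<longleftrightarrow> sat ?M (updates f xs \<xi>) (g(D := \<alpha>)) H" for \<xi> \<alpha>
  obtain F where F: "finite F"
    "\<And>\<pi> \<xi> \<alpha>. fixing c F \<pi> \<Longrightarrow> Q (map \<pi> \<xi>) (map \<pi> ` \<alpha>) \<longleftrightarrow> Q \<xi> \<alpha>"
    unfolding Q_def using sat_perm_model_supported[OF H asg, of xs D] by metis
  have exQ: "\<exists>\<alpha>\<in>preds ?M (psort D). Q \<xi> \<alpha>" if "\<xi> \<in> tuples UNIV (length xs)" for \<xi>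
    using ex that by (simp add: Q_def)
  \<comment> \<open>Permutations fixing the larger set \<open>E\<close> still respect
    \<open>Q\<close>, and over \<open>E\<close> the witnesses are uniformly supported.\<close>
  obtain E where E: "finite E" "F \<subseteq> E" "\<And>\<xi>. \<xi> \<in> tuples UNIV (length xs) \<Longrightarrow>
      \<exists>\<alpha>\<in>preds ?M (psort D). Q \<xi> \<alpha> \<and> supports c (E \<union> set \<xi>) \<alpha>"
    using uniform_support[of c F Q "length xs" "psort D", OF inf F exQ] by blast
  obtain T where T: "\<And>\<xi>. \<xi> \<in> tuples UNIV (length xs) \<Longrightarrow> T \<xi> \<in> preds ?M (psort D) \<and> Q \<xi> (T \<xi>)"
    and equi: "\<And>\<pi> \<xi>. fixing c E \<pi> \<Longrightarrow> \<xi> \<in> tuples UNIV (length xs) \<Longrightarrow> T (map \<pi> \<xi>) = map \<pi> ` T \<xi>"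
    using equivariant_choice[of c E Q "length xs" "psort D", OF F(2)[OF fixing_mono[OF _ E(2)]] E(3)]
    by blast
  \<comment> \<open>Equivariance of \<open>T\<close> says precisely that its graph is closed under
    the permutations fixing \<open>E\<close>.\<close>
  have "supports c E (choice_graph ?M (length xs) T)"
  proof (rule supportsI)
    fix \<pi> \<zeta>
    assume \<pi>: "fixing c E \<pi>" and "\<zeta> \<in> choice_graph ?M (length xs) T"
    then obtain \<xi> \<eta> where \<zeta>: "\<zeta> = \<xi> @ \<eta>" "\<xi> \<in> tuples UNIV (length xs)" "\<eta> \<in> T \<xi>"
      by (auto simp: choice_graph_def)
    then have "map \<pi> \<eta> \<in> T (map \<pi> \<xi>)" "map \<pi> \<xi> \<in> tuples UNIV (length xs)"
      using equi[OF \<pi>] by (auto simp: tuples_def)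
    then show "map \<pi> \<zeta> \<in> choice_graph ?M (length xs) T"
      using \<zeta>(1) by (auto simp: choice_graph_def)
  qed
  moreover have "choice_graph ?M (length xs) T \<subseteq> tuples UNIV (length xs + psort D)"
    using T by (fastforce simp: choice_graph_def preds_perm_model tuples_def)
  ultimately have "choice_graph ?M (length xs) T \<in> preds ?M (length xs + psort D)"
    using E(1) by (auto simp: preds_perm_model)
  with T show "\<exists>T. (\<forall>\<xi>\<in>tuples (indiv ?M) (length xs).
        T \<xi> \<in> preds ?M (psort D) \<and> sat ?M (updates f xs \<xi>) (g(D := T \<xi>)) H) \<and>
      choice_graph ?M (length xs) T \<in> preds ?M (length xs + psort D)"
    by (auto simp: Q_def)
qed


section \<open>Failure of trichotomy in the permutation model\<close>

text \<open>Constant tuples turn a colour class into an \<open>n\<close>-ary predicate; for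
  \<open>n \<ge> 1\<close> distinct points give distinct tuples.\<close>

definition diagonal :: "('a \<Rightarrow> bool) \<Rightarrow> nat \<Rightarrow> bool \<Rightarrow> 'a list set" where
  "diagonal c n b = {replicate n a | a. c a = b}"

lemma diagonal_in_preds: "diagonal c n b \<in> preds (perm_model c) n"
proof -
  have "supports c {} (diagonal c n b)"
    by (rule supportsI) (auto simp: diagonal_def fixing_def cperm_def)
  moreover have "diagonal c n b \<subseteq> tuples UNIV n"
    by (auto simp: diagonal_def tuples_def)
  ultimately show ?thesis by (auto simp: preds_perm_model)
qed

text \<open>Swapping individuals of one colour outside a support of an injection shows first that the image
  of a point lies in the support, and then that this image is shared by other points.\<close>

lemma no_injection_between_diagonals:
  assumes inf: "\<And>b. infinite {x. c x = b}" and n: "n \<ge> 1" and R: "R \<in> preds (perm_model c) (2 * n)"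
    and fn: "\<forall>\<xi>\<in>diagonal c n b. \<exists>\<eta>\<in>diagonal c n (\<not> b).
      \<xi> @ \<eta> \<in> R \<and> (\<forall>\<zeta>\<in>diagonal c n (\<not> b). \<xi> @ \<zeta> \<in> R \<longrightarrow> \<zeta> = \<eta>)"
    and inj: "\<forall>\<xi>\<in>diagonal c n b. \<forall>\<xi>'\<in>diagonal c n b. \<forall>\<eta>\<in>diagonal c n (\<not> b).
      \<xi> @ \<eta> \<in> R \<longrightarrow> \<xi>' @ \<eta> \<in> R \<longrightarrow> \<xi> = \<xi>'"
  shows False
proof -
  obtain E where E: "finite E" "supports c E R" using R by (auto simp: preds_perm_model)
  have fresh: "\<exists>x. c x = d \<and> x \<notin> X" if "finite X" for d X
  proof -
    have "infinite ({x. c x = d} - X)" using inf[of d] that by simp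
    then have "{x. c x = d} - X \<noteq> {}" by (rule infinite_imp_nonempty)
    then show ?thesis by blast
  qed
  \<comment> \<open>A point in the domain of the injection that permutations fixing \<open>E\<close>
    are free to move.\<close>
  obtain a where a: "c a = b" "a \<notin> E" using fresh E(1) by blast
  have diag: "replicate n x \<in> diagonal c n d" if "c x = d" for x d
    using that by (auto simp: diagonal_def)
  obtain \<eta> where \<eta>: "\<eta> \<in> diagonal c n (\<not> b)" "replicate n a @ \<eta> \<in> R"
    and uniq: "\<And>\<zeta>. \<zeta> \<in> diagonal c n (\<not> b) \<Longrightarrow> replicate n a @ \<zeta> \<in> R \<Longrightarrow> \<zeta> = \<eta>"
    using bspec[OF fn diag[OF a(1)]] by blast
  from \<eta>(1) obtain y where y: "c y = (\<not> b)" "\<eta> = replicate n y"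
    by (auto simp: diagonal_def)
  have move: "replicate n (\<pi> a) @ replicate n (\<pi> y) \<in> R" if "fixing c E \<pi>" for \<pi>
  proof -
    have "map \<pi> (replicate n a @ \<eta>) \<in> map \<pi> ` R" using \<eta>(2) by (rule imageI)
    also have "map \<pi> ` R = R" using E(2) that by (simp add: supports_def)
    finally show ?thesis by (simp add: y(2))
  qed
  have "y \<in> E"
  proof (rule ccontr)
    assume "y \<notin> E"
    obtain z where z: "c z = (\<not> b)" "z \<notin> insert y E" using fresh E(1) by (metis finite_insert)
    \<comment> \<open>\<open>a\<close> has the colour opposite to that of \<open>y\<close> and
      \<open>z\<close>, so the swap leaves it alone and gives it a second image.\<close>
    have "transpose y z a = a" using a y(1) z by (auto simp: transpose_def)
    then have "replicate n a @ replicate n z \<in> R"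
      using move[OF fixing_transpose[of c y z E]] y(1) z \<open>y \<notin> E\<close> by simp
    then have "replicate n z = replicate n y" using uniq[OF diag[OF z(1)]] y(2) by simp
    then show False using n z by simp
  qed
  obtain x where x: "c x = b" "x \<notin> insert a E" using fresh E(1) by (metis finite_insert)
  \<comment> \<open>\<open>y\<close> lies in \<open>E\<close>, while \<open>a\<close> and
    \<open>x\<close> do not; the swap thus gives \<open>x\<close> the same image as
    \<open>a\<close>.\<close>
  have "transpose a x y = y" using a x \<open>y \<in> E\<close> by (auto simp: transpose_def)
  then have "replicate n x @ replicate n y \<in> R"
    using move[OF fixing_transpose[of c a x E]] a x by simp
  then have "replicate n x = replicate n a"
    using inj diag[OF a(1)] diag[OF x(1)] \<eta> y(2) by blast
  then show False using n x by simp
qed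

lemma perm_model_not_TR:
  assumes inf: "\<And>b. infinite {x. c x = b}" and n: "n \<ge> 1"
  shows "\<not> sat (perm_model c) f g (TR n)"
proof
  let ?g = "g(PVar n 0 := diagonal c n True, PVar n 1 := diagonal c n False)"
  have sub: "diagonal c n b \<subseteq> tuples UNIV n" for b
    by (auto simp: diagonal_def tuples_def)
  assume "sat (perm_model c) f g (TR n)"
  then have "sat (perm_model c) f ?g (lesssim n (PVar n 0) (PVar n 1)) \<or>
      sat (perm_model c) f ?g (lesssim n (PVar n 1) (PVar n 0))"
    unfolding sat_TR using diagonal_in_preds by blast
  \<comment> \<open>Each disjunct gives an injection between the two diagonals, the Boolean naming
    the colour of its domain.\<close>
  then show False
  proof
    assume "sat (perm_model c) f ?g (lesssim n (PVar n 0) (PVar n 1))"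
    then show False
      using no_injection_between_diagonals[OF inf n, of _ True] n
      by (subst (asm) sat_lesssim) (auto simp: sub)
  next
    assume "sat (perm_model c) f ?g (lesssim n (PVar n 1) (PVar n 0))"
    then show False
      using no_injection_between_diagonals[OF inf n, of _ False] n
      by (subst (asm) sat_lesssim) (auto simp: sub)
  qed
qed

text \<open>The even terms of an injective sequence get one colour and everything else, including
  the odd terms, gets the other.\<close>

lemma ex_balanced_colouring:
  assumes "infinite (UNIV :: 'a set)"
  obtains c :: "'a \<Rightarrow> bool" where "\<And>b. infinite {x. c x = b}"
proof -
  obtain h :: "nat \<Rightarrow> 'a" where h: "inj h"
    using assms infinite_countable_subset by blast
  define c where "c x \<longleftrightarrow> x \<in> range (\<lambda>k. h (2 * k))" for x
  have "range (\<lambda>k. h (2 * k)) \<subseteq> {x. c x = True}" by (auto simp: c_def)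
  moreover have "range (\<lambda>k. h (Suc (2 * k))) \<subseteq> {x. c x = False}"
    by (auto simp: c_def inj_eq[OF h]) presburger
  moreover have "infinite (range (\<lambda>k. h (2 * k)))"
    by (rule range_inj_infinite, rule injI) (simp add: inj_eq[OF h])
  moreover have "infinite (range (\<lambda>k. h (Suc (2 * k))))"
    by (rule range_inj_infinite, rule injI) (simp add: inj_eq[OF h])
  ultimately have "infinite {x. c x = True}" "infinite {x. c x = False}"
    using infinite_super by blast+
  then have "infinite {x. c x = b}" for b by (cases b) simp_all
  then show thesis by (rule that)
qed

theorem theorem4p6:
  fixes n :: nat
  assumes "n \<ge> 1"
    and "infinite (UNIV :: 'a set)"
  shows "hpl_independent TYPE('a) (TR n) choice_h2"
proof -
  obtain c :: "'a \<Rightarrow> bool" where c: "\<And>b. infinite {x. c x = b}"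
    using ex_balanced_colouring[OF assms(2)] by blast
  \<comment> \<open>\<open>undefined\<close> serves as an arbitrary point of the type, to form a
    domain with one individual.\<close>
  let ?P = "perm_model c" and ?F = "full_structure {undefined :: 'a}"
  obtain f g where "assignment ?P f g"
    by (rule ex_assignment[OF predicate_structure_perm_model])
  then have "\<not> models ?P (TR n)"
    using perm_model_not_TR[OF c assms(1)] by (auto simp: models_def)
  moreover have "henkin_asser ?P" by (rule henkin_asser_perm_model)
  moreover have "\<forall>\<phi>\<in>choice_h2. models ?P \<phi>" using perm_model_models_choice_h2[OF c] by blast
  ultimately have "\<not> hpl_consequence TYPE('a) choice_h2 (TR n)"
    unfolding hpl_consequence_def by blast
  moreover have "\<not> hpl_consequence TYPE('a) choice_h2 (Neg (TR n))"
  proof -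
    obtain f g where "assignment ?F f g"
      by (rule ex_assignment[OF predicate_structure_full[OF insert_not_empty]])
    moreover have "models ?F (TR n)" by (rule full_singleton_models_TR[OF assms(1)])
    ultimately have "\<not> models ?F (Neg (TR n))"
      by (auto simp: models_def)
    moreover have "henkin_asser ?F" by (rule henkin_asser_full) simp
    moreover have "\<forall>\<phi>\<in>choice_h2. models ?F \<phi>" using full_models_choice_h2 by blast
    ultimately show ?thesis
      unfolding hpl_consequence_def by blast
  qed
  ultimately show ?thesis
    using sentence_TR[OF assms(1)] by (simp add: hpl_independent_def)
qed

end
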